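(* Let $H=(V,E(H))$ be a connected graph with nonnegative edge costs $c'$, let $s\neq t$ be two fixed vertices of $V$, and let $G=(V,E)$ be the metric completion of $H$ with metric costs $c$. Let $Opt_{int}(LP_1)$ denote the minimum cost $c(x)$ of an integral vector $x$ satisfying all constraints of (L.P.1) on $G$, and let $Opt_{int}(LP_4)$ denote the minimum cost $c'(x)$ of an integral vector $x$ satisfying all constraints of (L.P.4) on $H$. Then $$Opt_{int}(LP_4)\le Opt_{int}(LP_1)\le \tfrac{3}{2}\,Opt_{int}(LP_4).$$ Moreover, both bounds are tight: there are instances with $Opt_{int}(LP_1)=Opt_{int}(LP_4)$, and there are instances (graphs $H$ with unit edge costs) for which the ratio $Opt_{int}(LP_1)/Opt_{int}(LP_4)$ is arbitrarily close to $\tfrac32$.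
   Context: The metric completion $G$ of $H$ is the complete graph on $V$ where the cost $c(u,v)$ of each pair $u\neq v$ is the $c'$-shortest-path distance between $u$ and $v$ in $H$. A cut is a set $S$ with $\emptyset\subsetneq S\subsetneq V$; it is an $s$-$t$ cut if $|S\cap\{s,t\}|=1$. $\delta(S)$ is the set of edges with exactly one end in $S$, $\delta(v)=\delta(\{v\})$, and $x(D)=\sum_{e\in D}x_e$. For a partition $\mathcal W=\{W_1,\dots,W_\ell\}$ of $V$, $\delta(\mathcal W)=\bigcup_i\delta(W_i)$ and $|\mathcal W|=\ell$. (L.P.1) on $G$: minimize $\sum_{e\in E}c_ex_e$ subject to $x(\delta(s))=x(\delta(t))=1$; $x(\delta(v))=2$ for all $v\neq s,t$; $x(\delta(S))\ge1$ for every $s$-$t$ cut $S$; $x(\delta(S))\ge 2$ for every cut $S$ with $|S\cap\{s,t\}|$ even; $0\le x_e\le 1$ for all $e\in E$. (L.P.4) on $H$: minimize $\sum_{e\in E(H)}c'_ex_e$ subject to $x(\delta(\mathcal W))\ge|\mathcal W|-1$ for every partition $\mathcal W$ of $V$; $x(\delta(S))\ge 2$ for every cut $S$ with $|S\cap\{s,t\}|$ even; $x_e\ge0$ for all $e\in E(H)$ (here $\delta$ is taken in $H$). *)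

theory Defs
  imports Complex_Main "HOL-Library.Disjoint_Sets"
begin

text \<open>
  Finite simple undirected graphs are given by a vertex set \<open>V\<close> and a set \<open>E\<close> of
  two-element subsets of \<open>V\<close>. Vectors indexed by edges are functions on \<open>'a set\<close>, of which
  only the values on \<open>E\<close> matter.
\<close>

definition complete_edges :: "'a set \<Rightarrow> 'a set set" where
  "complete_edges V = {e. e \<subseteq> V \<and> card e = 2}"

definition graph :: "'a set \<Rightarrow> 'a set set \<Rightarrow> bool" where
  "graph V E \<longleftrightarrow> finite V \<and> E \<subseteq> complete_edges V"

definition is_path :: "'a set \<Rightarrow> 'a set set \<Rightarrow> 'a list \<Rightarrow> bool" where
  "is_path V E p \<longleftrightarrow>
     p \<noteq> [] \<and> set p \<subseteq> V \<and> distinct p \<and> successively (\<lambda>u v. {u, v} \<in> E) p"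

definition path_cost :: "('a set \<Rightarrow> real) \<Rightarrow> 'a list \<Rightarrow> real" where
  "path_cost c p = sum_list (map2 (\<lambda>u v. c {u, v}) p (tl p))"

definition connected_graph :: "'a set \<Rightarrow> 'a set set \<Rightarrow> bool" where
  "connected_graph V E \<longleftrightarrow>
     graph V E \<and> V \<noteq> {} \<and> (\<forall>u\<in>V. \<forall>v\<in>V. \<exists>p. is_path V E p \<and> hd p = u \<and> last p = v)"

text \<open>
  The cost of the pair \<open>e = {u, v}\<close> in the metric completion of \<open>(V, E)\<close>. The minimum is
  over a finite set, which is nonempty if the graph is connected.
\<close>

definition metric_cost :: "'a set \<Rightarrow> 'a set set \<Rightarrow> ('a set \<Rightarrow> real) \<Rightarrow> 'a set \<Rightarrow> real" where
  "metric_cost V E c e = Min {path_cost c p | p. is_path V E p \<and> {hd p, last p} = e}"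

definition is_cut :: "'a set \<Rightarrow> 'a set \<Rightarrow> bool" where
  "is_cut V S \<longleftrightarrow> S \<noteq> {} \<and> S \<subset> V"

definition delta :: "'a set set \<Rightarrow> 'a set \<Rightarrow> 'a set set" where
  "delta E S = {e \<in> E. card (e \<inter> S) = 1}"

definition delta_partition :: "'a set set \<Rightarrow> 'a set set \<Rightarrow> 'a set set" where
  "delta_partition E W = (\<Union>S\<in>W. delta E S)"

definition LP1_feasible ::
  "'a set \<Rightarrow> 'a set set \<Rightarrow> 'a \<Rightarrow> 'a \<Rightarrow> ('a set \<Rightarrow> real) \<Rightarrow> bool" where
  "LP1_feasible V E s t x \<longleftrightarrow>
     sum x (delta E {s}) = 1 \<and> sum x (delta E {t}) = 1 \<and>
     (\<forall>v\<in>V - {s, t}. sum x (delta E {v}) = 2) \<and>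
     (\<forall>S. is_cut V S \<and> card (S \<inter> {s, t}) = 1 \<longrightarrow> sum x (delta E S) \<ge> 1) \<and>
     (\<forall>S. is_cut V S \<and> even (card (S \<inter> {s, t})) \<longrightarrow> sum x (delta E S) \<ge> 2) \<and>
     (\<forall>e\<in>E. 0 \<le> x e \<and> x e \<le> 1)"

definition LP4_feasible ::
  "'a set \<Rightarrow> 'a set set \<Rightarrow> 'a \<Rightarrow> 'a \<Rightarrow> ('a set \<Rightarrow> real) \<Rightarrow> bool" where
  "LP4_feasible V E s t x \<longleftrightarrow>
     (\<forall>W. partition_on V W \<longrightarrow> sum x (delta_partition E W) \<ge> real (card W) - 1) \<and>
     (\<forall>S. is_cut V S \<and> even (card (S \<inter> {s, t})) \<longrightarrow> sum x (delta E S) \<ge> 2) \<and>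
     (\<forall>e\<in>E. x e \<ge> 0)"

definition is_min_int_cost ::
  "'a set set \<Rightarrow> ('a set \<Rightarrow> real) \<Rightarrow> (('a set \<Rightarrow> real) \<Rightarrow> bool) \<Rightarrow> real \<Rightarrow> bool" where
  "is_min_int_cost E c feasible m \<longleftrightarrow>
     (\<exists>x. feasible x \<and> (\<forall>e\<in>E. x e \<in> \<int>) \<and> (\<Sum>e\<in>E. c e * x e) = m) \<and>
     (\<forall>x. feasible x \<and> (\<forall>e\<in>E. x e \<in> \<int>) \<longrightarrow> m \<le> (\<Sum>e\<in>E. c e * x e))"

definition is_Opt_int_LP1 ::
  "'a set \<Rightarrow> 'a set set \<Rightarrow> ('a set \<Rightarrow> real) \<Rightarrow> 'a \<Rightarrow> 'a \<Rightarrow> real \<Rightarrow> bool" where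
  "is_Opt_int_LP1 V E c s t =
     is_min_int_cost (complete_edges V) (metric_cost V E c) (LP1_feasible V (complete_edges V) s t)"

definition is_Opt_int_LP4 ::
  "'a set \<Rightarrow> 'a set set \<Rightarrow> ('a set \<Rightarrow> real) \<Rightarrow> 'a \<Rightarrow> 'a \<Rightarrow> real \<Rightarrow> bool" where
  "is_Opt_int_LP4 V E c s t = is_min_int_cost E c (LP4_feasible V E s t)"

definition st_instance ::
  "'a set \<Rightarrow> 'a set set \<Rightarrow> ('a set \<Rightarrow> real) \<Rightarrow> 'a \<Rightarrow> 'a \<Rightarrow> bool" where
  "st_instance V E c s t \<longleftrightarrow>
     connected_graph V E \<and> (\<forall>e\<in>E. c e \<ge> 0) \<and> s \<in> V \<and> t \<in> V \<and> s \<noteq> t"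

end

theory Submission imports Defs "HOL-Library.FuncSet" begin

text \<open>
  Replacing each edge of an integral solution of (L.P.1) by a shortest path of \<open>H\<close> gives an
  integral solution of (L.P.4) of the same cost, because a path crosses every cut that separates
  its ends.

  Conversely, let \<open>n\<close> be an integral solution of (L.P.4) with support \<open>F\<close>. For a set
  \<open>D \<subseteq> F\<close> whose odd-degree vertices are exactly \<open>s\<close> and \<open>t\<close>, taking the edges of \<open>D\<close> once and
  those of \<open>F - D\<close> twice gives a connected multigraph with an Eulerian \<open>s\<close>-\<open>t\<close> walk, which is
  shortcut to a Hamiltonian path of the metric completion. Averaged over all such \<open>D\<close>, an edge
  \<open>e\<close> is used at most \<open>3/2 \<cdot> n e\<close> times: if it lies on a cycle, the symmetric difference with that
  cycle pairs the sets containing \<open>e\<close> with those avoiding it; if it is a bridge with \<open>n e = 1\<close>, the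
  constraints on even cuts force it to separate \<open>s\<close> from \<open>t\<close>, so it lies in every \<open>D\<close>.

  The ratio tends to \<open>3/2\<close> on the cycle of length \<open>2k\<close> with \<open>s\<close> and \<open>t\<close> antipodal. The cycle itself
  is feasible for (L.P.4). For an expanded solution of (L.P.1), the multiplicities of the edges on
  one \<open>s\<close>-\<open>t\<close> arc are all odd, and those on the other arc are even with at most one of them zero.
\<close>

subsection \<open>Walks\<close>

text \<open>A list rather than a set, so that \<open>count_list\<close> recovers how often a walk
  uses an edge.\<close>

fun walk_edges :: "'a list \<Rightarrow> 'a set list" where
  "walk_edges (u # v # p) = {u, v} # walk_edges (v # p)"
| "walk_edges _ = []"

definition walk :: "'a set set \<Rightarrow> 'a \<Rightarrow> 'a list \<Rightarrow> 'a \<Rightarrow> bool" where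
  "walk E u p v \<longleftrightarrow> p \<noteq> [] \<and> hd p = u \<and> last p = v \<and> set (walk_edges p) \<subseteq> E"

definition crossings :: "'a set \<Rightarrow> 'a list \<Rightarrow> nat" where
  "crossings S p = length (filter (\<lambda>e. card (e \<inter> S) = 1) (walk_edges p))"

lemma walk_edges_Cons: "p \<noteq> [] \<Longrightarrow> walk_edges (u # p) = {u, hd p} # walk_edges p"
  by (cases p) auto

lemma walk_edges_append_left:
  "xs \<noteq> [] \<Longrightarrow> walk_edges (xs @ ys) = walk_edges xs @ walk_edges (last xs # ys)"
  by (induction xs rule: walk_edges.induct) (auto simp: walk_edges_Cons)

lemma walk_edges_append_right:
  "ys \<noteq> [] \<Longrightarrow> walk_edges (xs @ ys) = walk_edges (xs @ [hd ys]) @ walk_edges ys"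
  using walk_edges_append_left[of "xs @ [hd ys]" "tl ys"] by simp

lemma walk_edges_rev: "walk_edges (rev p) = rev (walk_edges p)"
proof (induction p rule: walk_edges.induct)
  case (1 u v p)
  have "walk_edges (rev (u # v # p)) = walk_edges (rev (v # p)) @ walk_edges [v, u]"
    using walk_edges_append_left[of "rev (v # p)" "[u]"] by simp
  with 1 show ?case by (simp add: insert_commute)
qed auto

lemma length_walk_edges: "length (walk_edges p) = length p - 1"
  by (induction p rule: walk_edges.induct) auto

lemma nth_walk_edges: "Suc i < length p \<Longrightarrow> walk_edges p ! i = {p ! i, p ! Suc i}"
proof (induction p arbitrary: i rule: walk_edges.induct)
  case (1 u v p)
  then show ?case by (cases i) auto
qed auto

lemma walk_edges_subset: "e \<in> set (walk_edges p) \<Longrightarrow> e \<subseteq> set p"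
  by (induction p rule: walk_edges.induct) auto

lemma set_walk_subset:
  assumes "set (walk_edges p) \<subseteq> E" "E \<subseteq> Pow V" "hd p \<in> V"
  shows "set p \<subseteq> V"
  using assms by (induction p rule: walk_edges.induct) auto

lemma successively_iff_walk_edges:
  "successively (\<lambda>u v. {u, v} \<in> E) p \<longleftrightarrow> set (walk_edges p) \<subseteq> E"
  by (induction p rule: walk_edges.induct) auto

lemma path_cost_eq: "path_cost c p = sum_list (map c (walk_edges p))"
  unfolding path_cost_def by (induction p rule: walk_edges.induct) auto

lemma walk_append:
  assumes "walk E u p v" "walk E v q w"
  shows "walk E u (p @ tl q) w" and "path_cost c (p @ tl q) = path_cost c p + path_cost c q"
proof -
  have p: "p \<noteq> []" "last p = v" and q: "q \<noteq> []" "hd q = v" "last q = w"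
    using assms by (auto simp: walk_def)
  then have "last p # tl q = q" by (metis list.collapse)
  then have *: "walk_edges (p @ tl q) = walk_edges p @ walk_edges q"
    using walk_edges_append_left[OF p(1), of "tl q"] by simp
  show "walk E u (p @ tl q) w"
    using assms * by (cases q) (auto simp: walk_def)
  show "path_cost c (p @ tl q) = path_cost c p + path_cost c q"
    by (simp add: path_cost_eq *)
qed

lemma path_cost_rev: "path_cost c (rev p) = path_cost c p"
  by (simp add: path_cost_eq walk_edges_rev rev_map[symmetric] sum_list_rev)

text \<open>The walk changes sides of \<open>S\<close> exactly at the counted edges. A stationary
  step \<open>u = v\<close> would make \<open>{u, v}\<close> a singleton, counted without a change
  of side; the cardinality hypothesis excludes this.\<close>

lemma crossings_parity:
  assumes "p \<noteq> []" "\<forall>e\<in>set (walk_edges p). card e = 2"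
  shows "odd (crossings S p) \<longleftrightarrow> (hd p \<in> S) \<noteq> (last p \<in> S)"
  using assms
proof (induction p rule: walk_edges.induct)
  case (1 u v p)
  then have "u \<noteq> v" by auto
  moreover have "{u, v} \<inter> S = (if u \<in> S then {u} else {}) \<union> (if v \<in> S then {v} else {})"
    by auto
  ultimately have "card ({u, v} \<inter> S) = 1 \<longleftrightarrow> (u \<in> S) \<noteq> (v \<in> S)"
    by auto
  with 1 show ?case by (auto simp: crossings_def)
qed (auto simp: crossings_def)

lemma sum_list_count_list:
  fixes f :: "'a \<Rightarrow> 'b::comm_semiring_1"
  assumes "finite A" "set xs \<subseteq> A"
  shows "sum_list (map f xs) = (\<Sum>a\<in>A. f a * of_nat (count_list xs a))"
  using assms(2)
proof (induction xs)
  case (Cons x xs)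
  have "(\<Sum>a\<in>A. f a * of_nat (count_list (x # xs) a))
      = (\<Sum>a\<in>A. f a * of_nat (count_list xs a) + (if a = x then f a else 0))"
    by (intro sum.cong) (auto simp: algebra_simps)
  also have "\<dots> = (\<Sum>a\<in>A. f a * of_nat (count_list xs a)) + f x"
    using assms(1) Cons.prems by (simp add: sum.distrib)
  finally show ?case using Cons by (simp add: add.commute)
qed simp

lemma sum_count_list:
  assumes "finite E" "F \<subseteq> E" "set xs \<subseteq> E"
  shows "(\<Sum>e\<in>F. count_list xs e) = length (filter (\<lambda>e. e \<in> F) xs)"
proof -
  have "length (filter (\<lambda>e. e \<in> F) xs) = sum_list (map (\<lambda>e. if e \<in> F then 1 else (0::nat)) xs)"
    by (induction xs) auto
  also have "\<dots> = (\<Sum>e\<in>E. if e \<in> F then count_list xs e else 0)"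
    using assms by (subst sum_list_count_list[of E]) (auto intro!: sum.cong)
  also have "\<dots> = (\<Sum>e\<in>F. count_list xs e)"
    using assms by (simp add: sum.inter_restrict[symmetric] Int_absorb1)
  finally show ?thesis by simp
qed

lemma delta_subset: "delta E S \<subseteq> E"
  by (auto simp: delta_def)

lemma sum_delta_count_list:
  assumes "finite E" "set (walk_edges p) \<subseteq> E"
  shows "(\<Sum>e\<in>delta E S. count_list (walk_edges p) e) = crossings S p"
proof -
  have "filter (\<lambda>e. e \<in> delta E S) (walk_edges p)
      = filter (\<lambda>e. card (e \<inter> S) = 1) (walk_edges p)"
    using assms(2) by (intro filter_cong) (auto simp: delta_def)
  then show ?thesis
    using sum_count_list[OF assms(1) delta_subset assms(2)] by (simp add: crossings_def)
qed

text \<open>Serves to enlarge a trail: a closed walk put in place of one visit to \<open>w\<close>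
  adds its own edges and disturbs no others.\<close>

lemma walk_edges_splice:
  assumes "q \<noteq> []" "hd q = w" "last q = w"
  shows "count_list (walk_edges (xs @ q @ ys)) e
       = count_list (walk_edges (xs @ w # ys)) e + count_list (walk_edges q) e"
proof -
  have "walk_edges (xs @ q @ ys) = walk_edges (xs @ [w]) @ walk_edges q @ walk_edges (w # ys)"
    using walk_edges_append_right[of "q @ ys" xs] walk_edges_append_left[of q ys] assms by simp
  moreover have "walk_edges (xs @ w # ys) = walk_edges (xs @ [w]) @ walk_edges (w # ys)"
    using walk_edges_append_right[of "w # ys" xs] by simp
  ultimately show ?thesis by simp
qed

subsection \<open>Graphs and cuts\<close>

lemma finite_complete_edges: "finite V \<Longrightarrow> finite (complete_edges V)"
  unfolding complete_edges_def by (rule finite_subset[of _ "Pow V"]) auto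

lemma complete_edges_card: "e \<in> complete_edges V \<Longrightarrow> card e = 2"
  by (simp add: complete_edges_def)

lemma complete_edges_Pow: "complete_edges V \<subseteq> Pow V"
  by (auto simp: complete_edges_def)

lemma in_complete_edges: "{u, v} \<in> complete_edges V \<longleftrightarrow> u \<in> V \<and> v \<in> V \<and> u \<noteq> v"
  by (auto simp: complete_edges_def card_insert_if)

lemma complete_edgesE:
  assumes "e \<in> complete_edges V"
  obtains u v where "e = {u, v}" "u \<in> V" "v \<in> V" "u \<noteq> v"
  using assms by (auto simp: complete_edges_def card_2_iff)

lemma graph_finite:
  assumes "graph V E"
  shows "finite V" "finite E" "E \<subseteq> complete_edges V"
  using assms finite_complete_edges finite_subset unfolding graph_def by auto

lemma card_pair_Int_eq_1:
  "u \<noteq> v \<Longrightarrow> card ({u, v} \<inter> S) = 1 \<longleftrightarrow> (u \<in> S) \<noteq> (v \<in> S)"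
  by (auto simp: Int_insert_left)

lemma deltaE:
  assumes "e \<in> delta E S" "E \<subseteq> complete_edges V"
  obtains u v where "e = {u, v}" "u \<in> V" "v \<in> V" "u \<in> S" "v \<notin> S" "{u, v} \<in> E"
proof -
  have e: "e \<in> E" "card (e \<inter> S) = 1" using assms by (auto simp: delta_def)
  then obtain a b where ab: "e = {a, b}" "a \<in> V" "b \<in> V" "a \<noteq> b"
    using assms(2) complete_edgesE by blast
  then have "(a \<in> S) \<noteq> (b \<in> S)" using e card_pair_Int_eq_1 by metis
  with ab e that[of a b] that[of b a] show ?thesis by (auto simp: insert_commute)
qed

lemma deltaI:
  "{u, v} \<in> E \<Longrightarrow> u \<in> S \<Longrightarrow> v \<notin> S \<Longrightarrow> {u, v} \<in> delta E S"
  using card_pair_Int_eq_1[of u v S] by (auto simp: delta_def)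

lemma delta_singletonI: "e \<in> E \<Longrightarrow> v \<in> e \<Longrightarrow> e \<in> delta E {v}"
  by (auto simp: delta_def)

text \<open>Take for \<open>R\<close> the vertices reachable from \<open>u\<close>; an edge leaving
  \<open>R\<close> would extend a walk to a vertex outside \<open>R\<close>.\<close>

lemma reach_or_cut:
  assumes "E \<subseteq> complete_edges V" "u \<in> V" "v \<in> V" "\<not> (\<exists>p. walk E u p v)"
  obtains R where "R \<subseteq> V" "u \<in> R" "v \<notin> R" "delta E R = {}"
proof -
  define R where "R = {w \<in> V. \<exists>p. walk E u p w}"
  have "walk E u [u] u" by (simp add: walk_def)
  then have "u \<in> R" using assms by (auto simp: R_def)
  moreover have "delta E R = {}"
  proof (rule ccontr)
    assume "delta E R \<noteq> {}"
    then obtain e where "e \<in> delta E R" by auto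
    then obtain a b where ab: "b \<in> V" "a \<in> R" "b \<notin> R" "{a, b} \<in> E"
      using deltaE assms(1) by metis
    then obtain p where "walk E u p a" by (auto simp: R_def)
    moreover have "walk E a [a, b] b" using ab by (simp add: walk_def)
    ultimately have "walk E u (p @ tl [a, b]) b" by (rule walk_append)
    then show False using ab by (auto simp: R_def)
  qed
  ultimately show ?thesis using that[of R] assms by (auto simp: R_def)
qed

text \<open>The degree sum over \<open>S\<close> counts \<open>e\<close> with weight
  \<open>card (e \<inter> S)\<close>, which is 0, 1 or 2; modulo 2 only the edges of weight 1
  remain.\<close>

lemma handshake:
  fixes y :: "'a set \<Rightarrow> nat"
  assumes "finite V" "E \<subseteq> complete_edges V" "S \<subseteq> V"
  shows "even (\<Sum>v\<in>S. sum y (delta E {v})) \<longleftrightarrow> even (sum y (delta E S))"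
proof -
  have fE: "finite E" using assms finite_complete_edges finite_subset by blast
  have fS: "finite S" using assms finite_subset by blast
  have d: "sum y (delta E {v}) = (\<Sum>e\<in>E. if v \<in> e then y e else 0)" for v
    using fE by (auto simp: delta_def sum.inter_filter intro!: sum.cong)
  have "(\<Sum>v\<in>S. sum y (delta E {v})) = (\<Sum>e\<in>E. \<Sum>v\<in>S. if v \<in> e then y e else 0)"
    unfolding d by (rule sum.swap)
  also have "\<dots> = (\<Sum>e\<in>E. card (e \<inter> S) * y e)"
    using fS by (simp add: sum.inter_restrict[symmetric] Int_commute
        flip: sum.inter_filter)
  finally have 1: "(\<Sum>v\<in>S. sum y (delta E {v})) = (\<Sum>e\<in>E. card (e \<inter> S) * y e)" .
  have 2: "sum y (delta E S) = (\<Sum>e\<in>E. if card (e \<inter> S) = 1 then y e else 0)"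
    using fE by (simp add: delta_def sum.inter_filter)
  have "card (e \<inter> S) \<in> {0, 1, 2}" if "e \<in> E" for e
  proof -
    have "card e = 2" "finite e" using that assms(2) complete_edges_card card.infinite by fastforce+
    then have "card (e \<inter> S) \<le> 2" by (metis card_mono inf_le1)
    then show ?thesis by auto
  qed
  then have "{e \<in> E. odd (card (e \<inter> S) * y e)}
      = {e \<in> E. odd (if card (e \<inter> S) = 1 then y e else 0)}"
    by fastforce
  then show ?thesis unfolding 1 2 using fE by (simp add: even_sum_iff)
qed

subsection \<open>Eulerian walks\<close>

text \<open>\<open>y\<close> stands for a multigraph with \<open>y e\<close> parallel copies of
  \<open>e\<close>; a trail uses each copy at most once.\<close>

definition trail_in :: "('a set \<Rightarrow> nat) \<Rightarrow> 'a list \<Rightarrow> bool" where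
  "trail_in y p \<longleftrightarrow> (\<forall>e. count_list (walk_edges p) e \<le> y e)"

lemma trail_in_walk_edges:
  assumes "trail_in y p" "{e. y e > 0} \<subseteq> E"
  shows "set (walk_edges p) \<subseteq> E"
proof
  fix e assume "e \<in> set (walk_edges p)"
  then have "count_list (walk_edges p) e > 0" by (metis count_list_0_iff neq0_conv)
  also have "\<dots> \<le> y e" using assms(1) by (simp add: trail_in_def)
  finally show "e \<in> E" using assms(2) by blast
qed

lemma crossings_walk_parity:
  assumes "p \<noteq> []" "set (walk_edges p) \<subseteq> E" "E \<subseteq> complete_edges V"
  shows "odd (crossings S p) \<longleftrightarrow> (hd p \<in> S) \<noteq> (last p \<in> S)"
  using assms complete_edges_card by (intro crossings_parity) blast+

text \<open>A trail has at most as many edges as the total multiplicity, so lengths are bounded.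
  \<open>P\<close> is left open because longest trails are taken both with only the start prescribed
  and with both ends prescribed.\<close>

lemma longest_trail:
  assumes fE: "finite E" and y: "{e. y e > 0} \<subseteq> E"
    and p0: "trail_in y p0" "P p0"
  obtains p where "trail_in y p" "P p" "\<And>q. trail_in y q \<Longrightarrow> P q \<Longrightarrow> length q \<le> length p"
proof -
  have bound: "length p < sum y E + 2" if "trail_in y p" for p
  proof -
    have "length (walk_edges p) = (\<Sum>e\<in>E. count_list (walk_edges p) e)"
      using sum_count_list[OF fE order.refl trail_in_walk_edges[OF that y]]
        trail_in_walk_edges[OF that y] by (simp add: subset_iff filter_id_conv)
    also have "\<dots> \<le> sum y E" using that by (intro sum_mono) (simp add: trail_in_def)
    finally show ?thesis by (simp add: length_walk_edges)
  qed
  have "\<exists>p. (trail_in y p \<and> P p) \<and> (\<forall>q. trail_in y q \<and> P q \<longrightarrow> length q \<le> length p)"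
    using p0 bound
    by (intro ex_has_greatest_nat[where k = p0 and b = "sum y E + 2"]) blast+
  then show ?thesis using that by blast
qed

text \<open>A longest trail from \<open>s\<close> exhausts every edge at its last vertex, since
  otherwise it could be prolonged. The degree of that vertex thus equals a crossing number, whose
  parity reveals where the trail ends.\<close>

lemma maximal_trail:
  assumes fE: "finite E" and y: "{e. y e > 0} \<subseteq> E"
  obtains p where "p \<noteq> []" "hd p = s" "trail_in y p"
    "E \<subseteq> complete_edges V \<Longrightarrow> sum y (delta E {last p}) = crossings {last p} p"
proof -
  have "trail_in y [s]" by (simp add: trail_in_def)
  then obtain p where p: "trail_in y p" "p \<noteq> [] \<and> hd p = s"
    and max: "\<And>q. trail_in y q \<Longrightarrow> q \<noteq> [] \<and> hd q = s \<Longrightarrow> length q \<le> length p"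
    using longest_trail[OF fE y, where P = "\<lambda>p. p \<noteq> [] \<and> hd p = s"]
    by (metis list.discI list.sel(1))
  have "count_list (walk_edges p) e = y e" if "{last p, w} = e" for e w
  proof (rule ccontr)
    assume ne: "count_list (walk_edges p) e \<noteq> y e"
    have "walk_edges (p @ [w]) = walk_edges p @ [e]"
      using walk_edges_append_left[of p "[w]"] p(2) that by simp
    then have "trail_in y (p @ [w])"
      using p(1) ne by (auto simp: trail_in_def le_neq_implies_less Suc_leI)
    then have "length (p @ [w]) \<le> length p" using p(2) by (intro max) auto
    then show False by simp
  qed
  note full = this
  have "sum y (delta E {last p}) = crossings {last p} p" if E: "E \<subseteq> complete_edges V"
  proof -
    have "sum y (delta E {last p}) = (\<Sum>e\<in>delta E {last p}. count_list (walk_edges p) e)"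
    proof (rule sum.cong)
      fix e assume "e \<in> delta E {last p}"
      then obtain w where "{last p, w} = e" using deltaE[OF _ E] by (metis singletonD)
      then show "y e = count_list (walk_edges p) e" using full by metis
    qed simp
    then show ?thesis
      using sum_delta_count_list[OF fE trail_in_walk_edges[OF p(1) y]] by simp
  qed
  then show ?thesis using that[of p] p by blast
qed

text \<open>Hierholzer's argument on a longest trail from \<open>s\<close> to \<open>t\<close>. It
  is run only until all vertices are covered, not all edges, which is enough for
  shortcutting.\<close>

lemma eulerian_covering_walk:
  assumes fE: "finite E" and E: "E \<subseteq> complete_edges V" and y: "{e. y e > 0} \<subseteq> E"
    and s: "s \<in> V"
    and conn: "\<And>R. is_cut V R \<Longrightarrow> \<exists>e\<in>delta E R. y e > 0"
    and par: "\<And>v. v \<in> V \<Longrightarrow> odd (sum y (delta E {v})) \<longleftrightarrow> (v = s) \<noteq> (v = t)"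
  obtains p where "walk E s p t" "set p = V" "trail_in y p"
proof -
  have inV: "set p \<subseteq> V" if "trail_in z p" "{e. z e > 0} \<subseteq> E" "hd p \<in> V" for p z
    using set_walk_subset[OF trail_in_walk_edges[OF that(1,2)]] E complete_edges_Pow that(3)
    by blast
  obtain p0 where p0: "p0 \<noteq> []" "hd p0 = s" "trail_in y p0"
    and d0: "sum y (delta E {last p0}) = crossings {last p0} p0"
    using maximal_trail[OF fE y] E by metis
  have "last p0 \<in> V" using inV[OF p0(3) y] p0 s last_in_set by blast
  \<comment> \<open>The crossing number of \<open>{last p0}\<close> is odd iff
    \<open>last p0 \<noteq> s\<close>, whereas \<open>par\<close> makes the degree odd iff
    \<open>last p0\<close> is exactly one of \<open>s\<close> and \<open>t\<close>. The two agree
    only at \<open>t\<close>.\<close>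
  then have "last p0 = t"
    using par d0 p0(2) crossings_walk_parity[OF p0(1) trail_in_walk_edges[OF p0(3) y] E]
    by (metis singleton_iff)
  then obtain p where p: "trail_in y p" and ends': "p \<noteq> [] \<and> hd p = s \<and> last p = t"
    and max: "\<And>q. trail_in y q \<Longrightarrow> q \<noteq> [] \<and> hd q = s \<and> last q = t \<Longrightarrow> length q \<le> length p"
    using longest_trail[OF fE y p0(3), where P = "\<lambda>p. p \<noteq> [] \<and> hd p = s \<and> last p = t"] p0
    by metis
  have ends: "p \<noteq> []" "hd p = s" "last p = t" using ends' by auto
  have pE: "set (walk_edges p) \<subseteq> E" by (rule trail_in_walk_edges[OF p y])
  have "set p = V"
  proof (rule ccontr)
    assume "set p \<noteq> V"
    then have "is_cut V (set p)" using inV[OF p y] ends s by (auto simp: is_cut_def)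
    then obtain e where e: "e \<in> delta E (set p)" "y e > 0" using conn by blast
    then obtain w u where wu: "e = {w, u}" "w \<in> set p" "u \<notin> set p" "w \<in> V"
      using deltaE[OF e(1) E] by metis
    define z where "z e = y e - count_list (walk_edges p) e" for e
    have zE: "{e. z e > 0} \<subseteq> E" using y by (auto simp: z_def)
    have "e \<notin> set (walk_edges p)" using walk_edges_subset[of e p] wu by auto
    then have ze: "z e > 0" using e by (simp add: z_def count_list_0_iff)
    obtain q where q: "q \<noteq> []" "hd q = w" "trail_in z q"
      and dq: "sum z (delta E {last q}) = crossings {last q} q"
      using maximal_trail[OF fE zE] E by metis
    have lq: "last q \<in> V" using inV[OF q(3) zE] q wu(4) last_in_set by blast
    have "sum y (delta E {last q})
        = (\<Sum>e\<in>delta E {last q}. z e + count_list (walk_edges p) e)"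
      using p by (intro sum.cong) (auto simp: z_def trail_in_def)
    then have "sum y (delta E {last q}) = crossings {last q} q + crossings {last q} p"
      using sum_delta_count_list[OF fE pE, of "{last q}"] dq by (simp add: sum.distrib)
    moreover have "odd (crossings {last q} q) \<longleftrightarrow> w \<noteq> last q"
      using crossings_walk_parity[OF q(1) trail_in_walk_edges[OF q(3) zE] E, of "{last q}"] q(2)
      by simp
    moreover have "odd (crossings {last q} p) \<longleftrightarrow> (last q = s) \<noteq> (last q = t)"
      using crossings_walk_parity[OF ends(1) pE E, of "{last q}"] unfolding ends
      by (metis singleton_iff)
    \<comment> \<open>In the degree of \<open>last q\<close> the contribution of \<open>p\<close>
      already has the parity required by \<open>par\<close>, so \<open>q\<close> contributes an even
      number and is closed.\<close>
    ultimately have qw: "last q = w" using par[OF lq] by (metis even_add)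
    obtain xs ys where xy: "p = xs @ w # ys" using wu(2) split_list by metis
    let ?r = "xs @ q @ ys"
    have "count_list (walk_edges ?r) e = count_list (walk_edges p) e + count_list (walk_edges q) e"
      for e using walk_edges_splice[OF q(1,2) qw] xy by simp
    moreover have "count_list (walk_edges p) e + count_list (walk_edges q) e \<le> y e" for e
    proof -
      have "count_list (walk_edges q) e \<le> y e - count_list (walk_edges p) e"
        using q(3) by (simp add: trail_in_def z_def)
      moreover have "count_list (walk_edges p) e \<le> y e" using p by (simp add: trail_in_def)
      ultimately show ?thesis by linarith
    qed
    ultimately have "trail_in y ?r" by (simp add: trail_in_def)
    moreover have "hd ?r = hd p" using xy q by (cases xs) auto
    moreover have "last ?r = last p" using xy q qw by (cases ys rule: rev_cases) auto
    ultimately have "length ?r \<le> length p" using ends q(1) by (intro max) auto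
    then have "length q \<le> 1" using xy by simp
    then have qs: "q = [w]" using q(1,2) by (cases q) auto
    then have "sum z (delta E {w}) = 0" using dq by (simp add: crossings_def)
    moreover have "e \<in> delta E {w}"
      using e(1) delta_subset wu(1) by (intro delta_singletonI) auto
    moreover have "finite (delta E {w})" using fE delta_subset finite_subset by blast
    ultimately have "z e = 0" by simp
    with ze show False by simp
  qed
  then show ?thesis using that[of p] ends pE p by (simp add: walk_def)
qed

subsection \<open>The metric completion\<close>

lemma is_path_iff:
  "is_path V E p \<longleftrightarrow> p \<noteq> [] \<and> set p \<subseteq> V \<and> distinct p \<and> set (walk_edges p) \<subseteq> E"
  by (simp add: is_path_def successively_iff_walk_edges)

text \<open>The closed piece between two occurrences of a vertex is cut out repeatedly, which cannot
  raise the cost because costs are nonnegative.\<close>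

lemma walk_to_path:
  assumes "walk E u p v" "set p \<subseteq> V" "\<forall>e\<in>E. c e \<ge> 0"
  shows "\<exists>q. is_path V E q \<and> hd q = u \<and> last q = v \<and> path_cost c q \<le> path_cost c p"
  using assms(1,2)
proof (induction p rule: length_induct)
  case (1 p)
  show ?case
  proof (cases "distinct p")
    case True
    with 1 show ?thesis by (auto simp: walk_def is_path_iff)
  next
    case False
    then obtain xs ys zs w where p: "p = xs @ ([w] @ ys @ [w]) @ zs"
      using not_distinct_decomp by force
    have a: "walk_edges p
        = walk_edges (xs @ [w]) @ walk_edges ([w] @ ys @ [w]) @ walk_edges (w # zs)"
      using walk_edges_append_right[of "([w] @ ys @ [w]) @ zs" xs]
        walk_edges_append_left[of "[w] @ ys @ [w]" zs] p by simp
    let ?q = "xs @ w # zs"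
    have b: "walk_edges ?q = walk_edges (xs @ [w]) @ walk_edges (w # zs)"
      using walk_edges_append_right[of "w # zs" xs] by simp
    have "walk E u ?q v" using 1 a b p by (cases xs) (auto simp: walk_def)
    moreover have "length ?q < length p" "set ?q \<subseteq> V" using p 1 by auto
    ultimately obtain q where q: "is_path V E q" "hd q = u" "last q = v"
      "path_cost c q \<le> path_cost c ?q" using 1 by blast
    have "sum_list (map c (walk_edges ([w] @ ys @ [w]))) \<ge> 0"
      using a 1 assms(3) by (intro sum_list_nonneg) (auto simp: walk_def)
    then have "path_cost c ?q \<le> path_cost c p" unfolding path_cost_eq a b by simp
    with q show ?thesis by (intro exI[of _ q]) linarith
  qed
qed

lemma finite_paths: "finite V \<Longrightarrow> finite {p. is_path V E p}"
  by (rule finite_subset[OF _ finite_subset_distinct[of V]]) (auto simp: is_path_def)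

lemma metric_cost_attained:
  assumes "connected_graph V E" "u \<in> V" "v \<in> V"
  obtains p where "is_path V E p" "hd p = u" "last p = v"
    "path_cost c p = metric_cost V E c {u, v}"
proof -
  let ?A = "{path_cost c p | p. is_path V E p \<and> {hd p, last p} = {u, v}}"
  have "finite V" using assms by (simp add: connected_graph_def graph_def)
  then have "finite ?A" using finite_paths[of V E] by auto
  moreover obtain p where "is_path V E p \<and> hd p = u \<and> last p = v"
    using assms unfolding connected_graph_def by blast
  then have "?A \<noteq> {}" by blast
  ultimately have "Min ?A \<in> ?A" by (rule Min_in)
  then obtain p where p: "is_path V E p" "{hd p, last p} = {u, v}"
    "path_cost c p = metric_cost V E c {u, v}" by (auto simp: metric_cost_def)
  show ?thesis
  proof (cases "hd p = u \<and> last p = v")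
    case True
    then show ?thesis using that p by blast
  next
    case False
    \<comment> \<open>The minimum is over paths with a given unordered pair of ends, so the path
      found may run from \<open>v\<close> to \<open>u\<close>; reversing it keeps its cost.\<close>
    then have "hd p = v" "last p = u" using p(2) by (auto simp: doubleton_eq_iff)
    moreover have "is_path V E (rev p)" using p(1) by (auto simp: is_path_iff walk_edges_rev)
    ultimately show ?thesis
      using that[of "rev p"] p by (simp add: path_cost_rev hd_rev last_rev is_path_def)
  qed
qed

lemma is_path_walk: "is_path V E p \<Longrightarrow> walk E (hd p) p (last p)"
  by (simp add: is_path_iff walk_def)

lemma metric_cost_le_walk:
  assumes G: "graph V E" and c: "\<forall>e\<in>E. c e \<ge> 0"
    and p: "walk E u p v" "u \<in> V"
  shows "metric_cost V E c {u, v} \<le> path_cost c p"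
proof -
  have "set p \<subseteq> V"
    using set_walk_subset[of p E V] p graph_finite(3)[OF G] complete_edges_Pow
    by (auto simp: walk_def)
  then obtain q where q: "is_path V E q" "hd q = u" "last q = v" "path_cost c q \<le> path_cost c p"
    using walk_to_path[OF p(1) _ c] by blast
  have "finite {path_cost c p | p. is_path V E p \<and> {hd p, last p} = {u, v}}"
    using finite_paths[OF graph_finite(1)[OF G], of E] by auto
  then have "metric_cost V E c {u, v} \<le> path_cost c q"
    unfolding metric_cost_def using q by (intro Min_le) auto
  with q show ?thesis by linarith
qed

lemma path_cost_nonneg:
  "\<forall>e\<in>E. c e \<ge> 0 \<Longrightarrow> is_path V E p \<Longrightarrow> path_cost c p \<ge> 0"
  unfolding path_cost_eq is_path_iff by (intro sum_list_nonneg) auto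

lemma metric_cost_nonneg:
  assumes "connected_graph V E" "\<forall>e\<in>E. c e \<ge> 0" "u \<in> V" "v \<in> V"
  shows "metric_cost V E c {u, v} \<ge> 0"
  using metric_cost_attained[OF assms(1,3,4), of c] path_cost_nonneg[OF assms(2)] by metis

lemma metric_cost_triangle:
  assumes G: "connected_graph V E" and c: "\<forall>e\<in>E. c e \<ge> 0"
    and "u \<in> V" "v \<in> V" "w \<in> V"
  shows "metric_cost V E c {u, w} \<le> metric_cost V E c {u, v} + metric_cost V E c {v, w}"
proof -
  obtain p where p: "is_path V E p" "hd p = u" "last p = v"
    "path_cost c p = metric_cost V E c {u, v}" using metric_cost_attained[OF G] assms by metis
  obtain q where q: "is_path V E q" "hd q = v" "last q = w"
    "path_cost c q = metric_cost V E c {v, w}" using metric_cost_attained[OF G] assms by metis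
  have *: "walk E u p v" "walk E v q w" using is_path_walk p q by metis+
  show ?thesis
    using metric_cost_le_walk[OF _ c walk_append(1)[OF *] \<open>u \<in> V\<close>]
      walk_append(2)[OF *, of c] p q G by (simp add: connected_graph_def)
qed

lemma metric_cost_edge:
  assumes "graph V E" "\<forall>e\<in>E. c e \<ge> 0" "e \<in> E"
  shows "metric_cost V E c e \<le> c e"
proof -
  obtain u v where e: "e = {u, v}" "u \<in> V"
    using assms graph_finite(3) complete_edgesE by (metis subsetD)
  then have "walk E u [u, v] v" using assms by (simp add: walk_def)
  from metric_cost_le_walk[OF assms(1,2) this e(2)] e show ?thesis by (simp add: path_cost_eq)
qed

lemma path_cost_metric_le:
  assumes "graph V E" "\<forall>e\<in>E. c e \<ge> 0" "set (walk_edges p) \<subseteq> E"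
  shows "path_cost (metric_cost V E c) p \<le> path_cost c p"
  unfolding path_cost_eq using assms metric_cost_edge[OF assms(1,2)]
  by (intro sum_list_mono) auto

text \<open>Repeated vertices are deleted one at a time by the triangle inequality. A deleted
  occurrence must lie strictly inside the list, so that the ends survive, and its vertex must occur
  elsewhere, so that \<open>V\<close> stays covered.\<close>

lemma shortcut:
  assumes tri: "\<And>u v w. u \<in> V \<Longrightarrow> v \<in> V \<Longrightarrow> w \<in> V \<Longrightarrow> d {u, w} \<le> d {u, v} + (d {v, w} :: real)"
    and "p \<noteq> []" "hd p \<noteq> last p" "set p = V"
  shows "\<exists>q. distinct q \<and> set q = V \<and> hd q = hd p \<and> last q = last p \<and> path_cost d q \<le> path_cost d p"
  using assms(2-)
proof (induction p rule: length_induct)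
  case (1 p)
  have remove: ?case if p: "p = us @ [b] @ vs" "us \<noteq> []" "vs \<noteq> []" "b \<in> set us \<union> set vs" for us b vs
  proof -
    let ?q = "us @ vs"
    have "walk_edges p = walk_edges us @ [{last us, b}, {b, hd vs}] @ walk_edges vs"
      using walk_edges_append_left[of us "b # vs"] p walk_edges_Cons[of vs] by simp
    moreover have "walk_edges ?q = walk_edges us @ [{last us, hd vs}] @ walk_edges vs"
      using walk_edges_append_left[of us vs] p walk_edges_Cons[of vs] by simp
    moreover have "d {last us, hd vs} \<le> d {last us, b} + d {b, hd vs}"
      using p 1 by (intro tri) auto
    ultimately have "path_cost d ?q \<le> path_cost d p" by (simp add: path_cost_eq)
    moreover have q: "?q \<noteq> []" "hd ?q = hd p" "last ?q = last p" "set ?q = V"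
      and len: "length ?q < length p"
      using p 1(4) by auto
    moreover have "\<exists>r. distinct r \<and> set r = V \<and> hd r = hd ?q \<and> last r = last ?q \<and>
        path_cost d r \<le> path_cost d ?q"
      using 1(1)[rule_format, OF len q(1) _ q(4)] q 1(3) by simp
    ultimately show ?thesis by force
  qed
  show ?case
  proof (cases "distinct p")
    case True
    with 1 show ?thesis by blast
  next
    case False
    then obtain xs ys zs w where p: "p = xs @ [w] @ ys @ [w] @ zs"
      using not_distinct_decomp by blast
    show ?thesis
    proof (cases "zs = []")
      case True
      \<comment> \<open>The second occurrence of \<open>w\<close> ends the list, so the first is
        deleted instead; it does not start the list because the two ends differ.\<close>
      then have "xs \<noteq> []" using p 1(3) by auto
      then show ?thesis by (intro remove[of xs w "ys @ [w] @ zs"]) (simp_all add: p)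
    next
      case False
      then show ?thesis by (intro remove[of "xs @ [w] @ ys" w zs]) (simp_all add: p)
    qed
  qed
qed

subsection \<open>Averaging over joins\<close>

lemma odd_card_sym_diff:
  assumes "finite A" "finite B"
  shows "odd (card ((A - B) \<union> (B - A))) \<longleftrightarrow> odd (card A) \<noteq> odd (card B)"
proof -
  have "card ((A - B) \<union> (B - A)) = card (A - B) + card (B - A)"
    using assms by (intro card_Un_disjoint) auto
  moreover have "card A = card (A - B) + card (A \<inter> B)" "card B = card (B - A) + card (A \<inter> B)"
    using card_Int_Diff[OF assms(1), of B] card_Int_Diff[OF assms(2), of A]
    by (simp_all add: Int_commute)
  ultimately show ?thesis by (metis even_add)
qed

lemma delta_sym_diff:
  "delta ((C - D) \<union> (D - C)) S = (delta C S - delta D S) \<union> (delta D S - delta C S)"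
  by (auto simp: delta_def)

text \<open>The reduction of a walk modulo 2: repeated traversals cancel in pairs, so even a walk
  that is not a path yields an edge set with the right cut parities.\<close>

definition odd_edges :: "'a list \<Rightarrow> 'a set set" where
  "odd_edges p = {e. odd (count_list (walk_edges p) e)}"

lemma odd_edges_subset: "odd_edges p \<subseteq> set (walk_edges p)"
  unfolding odd_edges_def using count_list_0_iff even_zero by (metis (mono_tags) mem_Collect_eq subsetI)

lemma odd_card_delta_odd_edges:
  assumes "walk F u p v" "finite F" "F \<subseteq> complete_edges V"
  shows "odd (card (delta (odd_edges p) S)) \<longleftrightarrow> (u \<in> S) \<noteq> (v \<in> S)"
proof -
  have p: "p \<noteq> []" "hd p = u" "last p = v" "set (walk_edges p) \<subseteq> F"
    using assms by (auto simp: walk_def)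
  have "delta (odd_edges p) S = {e \<in> delta F S. odd (count_list (walk_edges p) e)}"
    using odd_edges_subset[of p] p(4) by (auto simp: delta_def odd_edges_def)
  moreover have "finite (delta F S)" using assms(2) delta_subset finite_subset by blast
  ultimately have "odd (card (delta (odd_edges p) S)) \<longleftrightarrow> odd (crossings S p)"
    by (simp add: even_sum_iff flip: sum_delta_count_list[OF assms(2) p(4)])
  then show ?thesis using crossings_walk_parity[OF p(1,4) assms(3)] p by simp
qed

text \<open>By \<open>handshake\<close> the parity of the cut is that of the number of odd-degree
  vertices in \<open>S\<close>, and these form \<open>S \<inter> {s, t}\<close>.\<close>

lemma odd_sum_delta_iff:
  fixes y :: "'a set \<Rightarrow> nat"
  assumes "finite V" "E \<subseteq> complete_edges V" "S \<subseteq> V" "s \<noteq> t"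
    and "\<And>v. v \<in> V \<Longrightarrow> odd (sum y (delta E {v})) \<longleftrightarrow> (v = s) \<noteq> (v = t)"
  shows "odd (sum y (delta E S)) \<longleftrightarrow> odd (card (S \<inter> {s, t}))"
proof -
  have "even (sum y (delta E S)) \<longleftrightarrow> even (\<Sum>v\<in>S. sum y (delta E {v}))"
    using handshake[OF assms(1-3), of y] by simp
  also have "\<dots> \<longleftrightarrow> even (card {v \<in> S. odd (sum y (delta E {v}))})"
    using assms finite_subset by (intro even_sum_iff) blast
  also have "{v \<in> S. odd (sum y (delta E {v}))} = S \<inter> {s, t}"
    using assms by blast
  finally show ?thesis by simp
qed

text \<open>For distinct \<open>s\<close> and \<open>t\<close> in \<open>V\<close> these are the
  T-joins inside \<open>F\<close> with T consisting of \<open>s\<close> and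
  \<open>t\<close>.\<close>

definition joins :: "'a set \<Rightarrow> 'a set set \<Rightarrow> 'a \<Rightarrow> 'a \<Rightarrow> 'a set set set" where
  "joins V F s t = {D. D \<subseteq> F \<and> (\<forall>v\<in>V. odd (card (delta D {v})) \<longleftrightarrow> (v = s) \<noteq> (v = t))}"

text \<open>Symmetric difference with a fixed set \<open>C\<close> that contains \<open>e\<close>
  and meets every cut evenly sends joins avoiding \<open>e\<close> injectively to joins containing
  \<open>e\<close>.\<close>

lemma joins_avoiding_edge:
  assumes F: "finite F" "F \<subseteq> complete_edges V"
    and e: "e = {u, v}" "e \<in> F" and p: "walk (F - {e}) u p v"
  shows "2 * card {D \<in> joins V F s t. e \<notin> D} \<le> card (joins V F s t)"
proof -
  let ?J = "joins V F s t"
  have fJ: "finite ?J" using F by (auto simp: joins_def)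
  \<comment> \<open>The walk \<open>p\<close> closed up by \<open>e\<close>, taken modulo 2. It need
    not be a single cycle; what counts is that it meets every cut in an even number of
    edges.\<close>
  define C where "C = insert e (odd_edges p)"
  have oF: "odd_edges p \<subseteq> F - {e}" using odd_edges_subset[of p] p by (auto simp: walk_def)
  moreover from this have "finite (odd_edges p)" using F(1) by (auto intro: finite_subset)
  ultimately have C: "C \<subseteq> F" "finite C" using e by (auto simp: C_def)
  have "u \<noteq> v" using F e in_complete_edges by (metis subsetD)
  have evenC: "even (card (delta C S))" for S
  proof -
    have "delta C S = (if (u \<in> S) \<noteq> (v \<in> S) then insert e (delta (odd_edges p) S)
        else delta (odd_edges p) S)"
      using card_pair_Int_eq_1[OF \<open>u \<noteq> v\<close>, of S] e by (auto simp: C_def delta_def)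
    moreover have "e \<notin> delta (odd_edges p) S" "finite (delta (odd_edges p) S)"
      using oF F delta_subset[of "odd_edges p" S] by (blast, auto intro: finite_subset)
    moreover have "odd (card (delta (odd_edges p) S)) \<longleftrightarrow> (u \<in> S) \<noteq> (v \<in> S)"
      using odd_card_delta_odd_edges[OF p] F by blast
    ultimately show ?thesis by (cases "(u \<in> S) = (v \<in> S)") auto
  qed
  define h where "h D = (D - C) \<union> (C - D)" for D
  have "h ` {D \<in> ?J. e \<notin> D} \<subseteq> {D \<in> ?J. e \<in> D}"
  proof
    fix X assume "X \<in> h ` {D \<in> ?J. e \<notin> D}"
    then obtain D where D: "D \<in> ?J" "e \<notin> D" "X = h D" by auto
    have DF: "D \<subseteq> F" using D by (simp add: joins_def)
    then have fin: "finite (delta D S)" "finite (delta C S)" for S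
      using C F delta_subset finite_subset by metis+
    have "odd (card (delta X S)) \<longleftrightarrow> odd (card (delta D S))" for S
      unfolding D(3) h_def delta_sym_diff odd_card_sym_diff[OF fin] using evenC by simp
    moreover have "X \<subseteq> F" "e \<in> X" using D DF C by (auto simp: h_def C_def)
    ultimately show "X \<in> {D \<in> ?J. e \<in> D}" using D by (simp add: joins_def)
  qed
  moreover have "inj_on h {D \<in> ?J. e \<notin> D}" by (rule inj_onI) (auto simp: h_def)
  ultimately have "card {D \<in> ?J. e \<notin> D} \<le> card {D \<in> ?J. e \<in> D}"
    using fJ by (intro card_inj_on_le) auto
  moreover have "card ?J = card {D \<in> ?J. e \<notin> D} + card {D \<in> ?J. e \<in> D}"
    using fJ by (subst card_Un_disjoint[symmetric]) (auto intro: arg_cong[of _ _ card])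
  ultimately show ?thesis by simp
qed

section \<open>Connectivity and bridges of the support of an integral solution of (L.P.4)\<close>

lemma delta_Compl:
  assumes "E \<subseteq> complete_edges V"
  shows "delta E (V - S) = delta E S"
proof -
  have "card (e \<inter> (V - S)) = 1 \<longleftrightarrow> card (e \<inter> S) = 1" if "e \<in> E" for e
  proof -
    from that assms have "e \<in> complete_edges V" by blast
    then obtain u v where uv: "e = {u, v}" "u \<in> V" "v \<in> V" "u \<noteq> v" by (rule complete_edgesE)
    then show ?thesis using card_pair_Int_eq_1[OF uv(4)] by auto
  qed
  then show ?thesis by (auto simp: delta_def)
qed

text \<open>The partition into \<open>R\<close> and its complement has two classes, so its
  constraint demands at least 1 on \<open>delta E R\<close>. Hence the support is connected.\<close>

lemma LP4_cut_edge:
  fixes n :: "'a set \<Rightarrow> nat"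
  assumes E: "E \<subseteq> complete_edges V" and feas: "LP4_feasible V E s t (\<lambda>e. real (n e))"
    and R: "is_cut V R"
  shows "\<exists>e\<in>delta E R. n e > 0"
proof (rule ccontr)
  assume *: "\<not> ?thesis"
  have ne: "R \<noteq> V - R" using R by (auto simp: is_cut_def)
  have "partition_on V {R, V - R}"
    using R by (auto simp: partition_on_def is_cut_def disjoint_def)
  then have "(\<Sum>e\<in>delta_partition E {R, V - R}. real (n e)) \<ge> real (card {R, V - R}) - 1"
    using feas unfolding LP4_feasible_def by blast
  also have "delta_partition E {R, V - R} = delta E R"
    using delta_Compl[OF E] by (simp add: delta_partition_def)
  also have "(\<Sum>e\<in>delta E R. real (n e)) = 0" using * by (intro sum.neutral) auto
  finally show False using ne by simp
qed

text \<open>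
  A non-bridge of the support is avoided by at most half of the joins; a bridge of multiplicity
  one separates \<open>s\<close> from \<open>t\<close>, so it lies in all of them.
\<close>

lemma joins_average:
  fixes n :: "'a set \<Rightarrow> nat"
  assumes G: "graph V E" and st: "s \<in> V" "t \<in> V" "s \<noteq> t"
    and feas: "LP4_feasible V E s t (\<lambda>e. real (n e))"
    and F: "F = {e \<in> E. n e > 0}" and e: "e \<in> F"
  shows "real (\<Sum>D\<in>joins V F s t. if e \<in> D then 1 else 2)
    \<le> 3 / 2 * real (n e) * real (card (joins V F s t))"
proof -
  let ?J = "joins V F s t"
  have FE: "F \<subseteq> E" and E: "E \<subseteq> complete_edges V" and fin: "finite V" "finite E"
    using F graph_finite[OF G] by auto
  then have F': "finite F" "F \<subseteq> complete_edges V" using finite_subset by auto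
  have fJ: "finite ?J" using F' by (auto simp: joins_def)
  \<comment> \<open>Each join contributes 1, plus an extra 1 if it avoids \<open>e\<close>, so it
    remains to bound the number of joins avoiding \<open>e\<close>.\<close>
  have "(\<Sum>D\<in>?J. if e \<in> D then 1 else (2::nat)) = (\<Sum>D\<in>?J. 1 + (if e \<notin> D then 1 else 0))"
    by (intro sum.cong) auto
  also have "\<dots> = card ?J + card {D \<in> ?J. e \<notin> D}"
    unfolding sum.distrib using fJ by (simp add: sum.inter_filter[symmetric])
  finally have sum: "(\<Sum>D\<in>?J. if e \<in> D then 1 else (2::nat)) = card ?J + card {D \<in> ?J. e \<notin> D}" .
  have n1: "n e \<ge> 1" using e F by simp
  obtain u v where uv: "e = {u, v}" "u \<in> V" "v \<in> V" "u \<noteq> v"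
    using e F' complete_edgesE by blast
  show ?thesis
  proof (cases "\<exists>p. walk (F - {e}) u p v")
    case True
    then have "2 * card {D \<in> ?J. e \<notin> D} \<le> card ?J"
      using joins_avoiding_edge[OF F' uv(1) e] by blast
    then have "real (card ?J + card {D \<in> ?J. e \<notin> D}) \<le> 3 / 2 * 1 * real (card ?J)" by simp
    also have "\<dots> \<le> 3 / 2 * real (n e) * real (card ?J)"
      using n1 by (intro mult_right_mono mult_left_mono) auto
    finally show ?thesis unfolding sum .
  next
    case False
    then obtain R where R: "R \<subseteq> V" "u \<in> R" "v \<notin> R" "delta (F - {e}) R = {}"
      using reach_or_cut[OF _ uv(2,3)] F' by (metis Diff_subset order.trans)
    have cut: "is_cut V R" using R uv by (auto simp: is_cut_def)
    have "e \<in> delta F R" unfolding uv(1) using e uv(1) R by (intro deltaI) auto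
    then have dF: "delta F R = {e}" using R(4) by (auto simp: delta_def)
    show ?thesis
    proof (cases "n e = 1")
      case True
      \<comment> \<open>Within the support only \<open>e\<close> crosses \<open>R\<close>, so the
        cut has value 1, less than the 2 demanded of even cuts; hence \<open>R\<close> separates
        \<open>s\<close> from \<open>t\<close>.\<close>
      have "(\<Sum>e\<in>delta E R. real (n e)) = (\<Sum>e\<in>delta F R. real (n e))"
        using fin FE F by (intro sum.mono_neutral_right) (auto simp: delta_def)
      then have "\<not> (\<Sum>e\<in>delta E R. real (n e)) \<ge> 2" using dF True by simp
      then have "odd (card (R \<inter> {s, t}))" using feas cut by (auto simp: LP4_feasible_def)
      then have oD: "odd (card (delta D R))" if "D \<in> ?J" for D
        using odd_sum_delta_iff[OF fin(1) _ R(1) st(3), of D "\<lambda>_. 1"] that F'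
        by (auto simp: joins_def)
      have "e \<in> D" if "D \<in> ?J" for D
      proof -
        have "delta D R \<subseteq> {e}" using dF that by (auto simp: joins_def delta_def)
        moreover have "delta D R \<noteq> {}" using oD[OF that] odd_card_imp_not_empty by blast
        ultimately show ?thesis using delta_subset by blast
      qed
      then have empty: "{D \<in> ?J. e \<notin> D} = {}" by blast
      show ?thesis unfolding sum True empty by simp
    next
      case False
      \<comment> \<open>Here the crude bound suffices: even two copies of \<open>e\<close> in every
        join stay below the allowed average of at least 3.\<close>
      then have "real (n e) \<ge> 2" using n1 by simp
      have "card {D \<in> ?J. e \<notin> D} \<le> card ?J" using fJ by (intro card_mono) auto
      then have "real (card ?J + card {D \<in> ?J. e \<notin> D}) \<le> 3 / 2 * 2 * real (card ?J)" by simp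
      also have "\<dots> \<le> 3 / 2 * real (n e) * real (card ?J)"
        using \<open>real (n e) \<ge> 2\<close> by (intro mult_right_mono mult_left_mono) auto
      finally show ?thesis unfolding sum .
    qed
  qed
qed

text \<open>Some join costs at most the average over all joins, which \<open>joins_average\<close>
  bounds edge by edge; the covering walk of its multigraph is then shortcut.\<close>

lemma hamiltonian_list_of_LP4:
  fixes n :: "'a set \<Rightarrow> nat"
  assumes G: "connected_graph V E" and c: "\<forall>e\<in>E. c e \<ge> 0"
    and st: "s \<in> V" "t \<in> V" "s \<noteq> t"
    and feas: "LP4_feasible V E s t (\<lambda>e. real (n e))"
  obtains q where "distinct q" "set q = V" "hd q = s" "last q = t"
    "path_cost (metric_cost V E c) q \<le> 3 / 2 * (\<Sum>e\<in>E. c e * real (n e))"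
proof -
  have gr: "graph V E" using G by (simp add: connected_graph_def)
  note fin = graph_finite[OF gr]
  define F where "F = {e \<in> E. n e > 0}"
  have F: "finite F" "F \<subseteq> complete_edges V" "F \<subseteq> E" using fin by (auto simp: F_def)
  let ?J = "joins V F s t"
  have fJ: "finite ?J" using F by (auto simp: joins_def)
  have conn: "\<exists>e. e \<in> delta F R" if "is_cut V R" for R
    using LP4_cut_edge[OF fin(3) feas that] by (auto simp: F_def delta_def)
  obtain p where p: "walk F s p t"
  proof (rule ccontr)
    assume "\<not> thesis"
    then have "\<not> (\<exists>p. walk F s p t)" using that by blast
    then obtain R where "R \<subseteq> V" "s \<in> R" "t \<notin> R" "delta F R = {}"
      using reach_or_cut[OF F(2) st(1,2)] by blast
    then show False using conn[of R] st by (auto simp: is_cut_def)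
  qed
  have "odd_edges p \<subseteq> F" using odd_edges_subset[of p] p by (auto simp: walk_def)
  \<comment> \<open>An \<open>s\<close>-\<open>t\<close> walk in the support, reduced modulo 2, is a
    join, so the average is over a nonempty set.\<close>
  then have "odd_edges p \<in> ?J"
    using odd_card_delta_odd_edges[OF p F(1,2)] by (auto simp: joins_def)
  then have J: "?J \<noteq> {}" by blast
  \<comment> \<open>Doubled edges do not affect degree parities, which are therefore those of
    \<open>D\<close>, while every support edge stays present and keeps the multigraph
    connected.\<close>
  define y where "y D e = (if e \<in> F then if e \<in> D then 1 else 2 else (0::nat))" for D e
  have avg: "(\<Sum>D\<in>?J. real (y D e)) \<le> 3 / 2 * real (n e) * real (card ?J)" if "e \<in> E" for e
  proof (cases "e \<in> F")
    case True
    then show ?thesis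
      using joins_average[OF gr st feas F_def True] by (simp add: y_def of_nat_sum)
  next
    case False
    then show ?thesis by (simp add: y_def)
  qed
  \<comment> \<open>If every join exceeded the bound, summing over the joins and exchanging the sums
    would contradict \<open>avg\<close>.\<close>
  have "\<exists>D\<in>?J. (\<Sum>e\<in>E. c e * real (y D e)) \<le> 3 / 2 * (\<Sum>e\<in>E. c e * real (n e))"
  proof (rule ccontr)
    assume "\<not> ?thesis"
    then have "3 / 2 * (\<Sum>e\<in>E. c e * real (n e)) < (\<Sum>e\<in>E. c e * real (y D e))" if "D \<in> ?J" for D
      using that by (meson not_le)
    then have "(\<Sum>D\<in>?J. 3 / 2 * (\<Sum>e\<in>E. c e * real (n e))) < (\<Sum>D\<in>?J. \<Sum>e\<in>E. c e * real (y D e))"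
      by (intro sum_strict_mono fJ J)
    also have "\<dots> = (\<Sum>e\<in>E. c e * (\<Sum>D\<in>?J. real (y D e)))"
      by (subst sum.swap) (simp add: sum_distrib_left)
    also have "\<dots> \<le> (\<Sum>e\<in>E. c e * (3 / 2 * real (n e) * real (card ?J)))"
      using avg c by (intro sum_mono mult_left_mono) auto
    also have "\<dots> = (\<Sum>D\<in>?J. 3 / 2 * (\<Sum>e\<in>E. c e * real (n e)))"
      by (simp add: sum_distrib_left sum_distrib_right mult_ac)
    finally show False by simp
  qed
  then obtain D where D: "D \<in> ?J"
    "(\<Sum>e\<in>E. c e * real (y D e)) \<le> 3 / 2 * (\<Sum>e\<in>E. c e * real (n e))" by blast
  have DF: "D \<subseteq> F" using D by (simp add: joins_def)
  have "{e. y D e > 0} \<subseteq> E" using F by (auto simp: y_def)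
  moreover have "\<exists>e\<in>delta E R. y D e > 0" if "is_cut V R" for R
    using conn[OF that] F(3) by (auto simp: y_def delta_def)
  moreover have "odd (sum (y D) (delta E {v})) \<longleftrightarrow> (v = s) \<noteq> (v = t)" if "v \<in> V" for v
  proof -
    have "finite (delta E {v})" using fin delta_subset finite_subset by metis
    moreover have "{e \<in> delta E {v}. odd (y D e)} = delta D {v}"
      using DF F(3) by (auto simp: y_def delta_def)
    ultimately show ?thesis using D that by (simp add: even_sum_iff joins_def)
  qed
  ultimately obtain w where w: "walk E s w t" "set w = V" "trail_in (y D) w"
    using eulerian_covering_walk[OF fin(2,3), of "y D" s t] st(1) by blast
  have wE: "set (walk_edges w) \<subseteq> E" using w by (simp add: walk_def)
  have "path_cost c w = (\<Sum>e\<in>E. c e * real (count_list (walk_edges w) e))"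
    unfolding path_cost_eq by (rule sum_list_count_list[OF fin(2) wE])
  also have "\<dots> \<le> (\<Sum>e\<in>E. c e * real (y D e))"
    using w(3) c by (intro sum_mono mult_left_mono) (auto simp: trail_in_def)
  finally have "path_cost (metric_cost V E c) w \<le> 3 / 2 * (\<Sum>e\<in>E. c e * real (n e))"
    using D(2) path_cost_metric_le[OF gr c wE] by linarith
  moreover have w': "w \<noteq> []" "hd w = s" "last w = t" using w(1) by (auto simp: walk_def)
  moreover obtain q where "distinct q" "set q = V" "hd q = hd w" "last q = last w"
    "path_cost (metric_cost V E c) q \<le> path_cost (metric_cost V E c) w"
    using shortcut[where d = "metric_cost V E c", OF metric_cost_triangle[OF G c] w'(1) _ w(2)]
      w' st(3) by blast
  ultimately show ?thesis using that[of q] by simp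
qed

subsection \<open>Hamiltonian lists and (L.P.1)\<close>

lemma odd_card_Int_pair:
  "s \<noteq> t \<Longrightarrow> odd (card (S \<inter> {s, t})) \<longleftrightarrow> (s \<in> S) \<noteq> (t \<in> S)"
  by (auto simp: Int_insert_right)

lemma card_Int_pair_eq_1:
  "s \<noteq> t \<Longrightarrow> card (S \<inter> {s, t}) = 1 \<longleftrightarrow> odd (card (S \<inter> {s, t}))"
  by (auto simp: Int_insert_right)

lemma crossings_Cons:
  "p \<noteq> [] \<Longrightarrow> crossings S (u # p) = (if card ({u, hd p} \<inter> S) = 1 then 1 else 0) + crossings S p"
  by (simp add: crossings_def walk_edges_Cons)

lemma crossings_append:
  "xs \<noteq> [] \<Longrightarrow> ys \<noteq> [] \<Longrightarrow> crossings S (xs @ ys)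
     = crossings S xs + (if card ({last xs, hd ys} \<inter> S) = 1 then 1 else 0) + crossings S ys"
  by (simp add: crossings_def walk_edges_append_left walk_edges_Cons)

lemma crossings_disjoint: "set p \<inter> S = {} \<Longrightarrow> crossings S p = 0"
proof -
  assume "set p \<inter> S = {}"
  then have "e \<inter> S = {}" if "e \<in> set (walk_edges p)" for e
    using walk_edges_subset[OF that] by blast
  then show ?thesis by (auto simp: crossings_def filter_empty_conv)
qed

lemma crossings_eq_0:
  assumes "crossings S p = 0" "\<forall>e\<in>set (walk_edges p). card e = 2"
  shows "set p \<subseteq> S \<or> set p \<inter> S = {}"
  using assms
proof (induction p rule: walk_edges.induct)
  case (1 u v p)
  then have "u \<noteq> v" by auto
  with 1 show ?case
    using card_pair_Int_eq_1[of u v S] by (auto simp: crossings_def split: if_splits)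
qed auto

lemma distinct_walk_edges: "distinct p \<Longrightarrow> distinct (walk_edges p)"
proof (induction p rule: walk_edges.induct)
  case (1 u v p)
  then show ?case using walk_edges_subset[of "{u, v}" "v # p"] by auto
qed auto

lemma distinct_walk_edges_complete:
  "distinct p \<Longrightarrow> set p \<subseteq> V \<Longrightarrow> set (walk_edges p) \<subseteq> complete_edges V"
  by (induction p rule: walk_edges.induct) (auto simp: in_complete_edges)

lemma count_list_distinct_le: "distinct xs \<Longrightarrow> count_list xs a \<le> 1"
  by (induction xs) (auto simp: count_list_0_iff)

text \<open>Each cut is crossed because \<open>q\<close> visits both sides, and it is crossed an
  even number of times, hence at least twice, unless it separates \<open>s\<close> from
  \<open>t\<close>.\<close>

lemma LP1_feasible_hamiltonian:
  assumes V: "finite V" and q: "distinct q" "set q = V" "hd q = s" "last q = t" and st: "s \<noteq> t"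
    and V0: "s \<in> V"
  shows "LP1_feasible V (complete_edges V) s t (\<lambda>e. real (count_list (walk_edges q) e))"
proof -
  let ?K = "complete_edges V"
  have fK: "finite ?K" using V by (rule finite_complete_edges)
  have qK: "set (walk_edges q) \<subseteq> ?K" using q by (intro distinct_walk_edges_complete) auto
  have ne: "q \<noteq> []" using V0 q by auto
  have sum: "(\<Sum>e\<in>delta ?K S. real (count_list (walk_edges q) e)) = real (crossings S q)" for S
    using sum_delta_count_list[OF fK qK, of S] by (simp flip: of_nat_sum)
  have par: "odd (crossings S q) \<longleftrightarrow> odd (card (S \<inter> {s, t}))" for S
    using crossings_walk_parity[OF ne qK order.refl] q st by (simp add: odd_card_Int_pair)
  have "crossings {s} q = 1"
  proof -
    obtain r where r: "q = s # r" using ne q(3) by (cases q) auto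
    with st q have "r \<noteq> []" "s \<notin> set r" by auto
    moreover from this have "hd r \<noteq> s" using hd_in_set by metis
    ultimately show ?thesis unfolding r by (simp add: crossings_Cons crossings_disjoint)
  qed
  moreover have "crossings {t} q = 1"
  proof -
    obtain r where r: "q = r @ [t]" using ne q(4) by (metis append_butlast_last_id)
    with st q have "r \<noteq> []" "t \<notin> set r" by auto
    then have "last r \<noteq> t" using last_in_set by blast
    with \<open>r \<noteq> []\<close> \<open>t \<notin> set r\<close> show ?thesis
      unfolding r by (simp add: crossings_append crossings_disjoint) (simp add: crossings_def)
  qed
  moreover have "crossings {v} q = 2" if v: "v \<in> V - {s, t}" for v
  proof -
    obtain xs ys where xy: "q = xs @ v # ys" using v q(2) by (metis DiffD1 split_list)
    then have "xs \<noteq> []" "ys \<noteq> []" using v q by auto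
    moreover have "v \<notin> set xs" "v \<notin> set ys" using xy q by auto
    moreover have "last xs \<noteq> v" "hd ys \<noteq> v"
      using calculation last_in_set hd_in_set by metis+
    ultimately show ?thesis
      unfolding xy by (simp add: crossings_append crossings_Cons crossings_disjoint)
  qed
  moreover have pos: "crossings S q \<noteq> 0" if "is_cut V S" for S
    using crossings_eq_0[of S q] qK complete_edges_card that q unfolding is_cut_def by blast
  moreover have "crossings S q \<ge> 2" if "is_cut V S" "even (card (S \<inter> {s, t}))" for S
  proof -
    have "even (crossings S q)" using par that by simp
    with pos[OF that(1)] show ?thesis by presburger
  qed
  moreover have "count_list (walk_edges q) e \<le> 1" for e
    using q by (intro count_list_distinct_le distinct_walk_edges)
  ultimately show ?thesis
    unfolding LP1_feasible_def sum by (auto simp: Suc_le_eq)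
qed

lemma LP1_feasible_cong:
  "(\<And>e. e \<in> E \<Longrightarrow> x e = y e) \<Longrightarrow> LP1_feasible V E s t x \<longleftrightarrow> LP1_feasible V E s t y"
proof -
  assume *: "\<And>e. e \<in> E \<Longrightarrow> x e = y e"
  then have "sum x (delta E S) = sum y (delta E S)" for S
    by (intro sum.cong) (auto simp: delta_def)
  then show ?thesis using * by (simp add: LP1_feasible_def)
qed

lemma LP4_feasible_cong:
  "(\<And>e. e \<in> E \<Longrightarrow> x e = y e) \<Longrightarrow> LP4_feasible V E s t x \<longleftrightarrow> LP4_feasible V E s t y"
proof -
  assume *: "\<And>e. e \<in> E \<Longrightarrow> x e = y e"
  then have "sum x (delta E S) = sum y (delta E S)"
    "sum x (delta_partition E W) = sum y (delta_partition E W)" for S W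
    by (intro sum.cong; auto simp: delta_def delta_partition_def)+
  then show ?thesis using * by (simp add: LP4_feasible_def)
qed

subsection \<open>Partition inequalities\<close>

lemma sum_eq_sum_if:
  "finite A \<Longrightarrow> B \<subseteq> A \<Longrightarrow> sum f B = (\<Sum>a\<in>A. if a \<in> B then f a else 0)"
  by (simp add: sum.inter_restrict[symmetric] Int_absorb1)

text \<open>An edge between different classes lies in the boundary of exactly two of them, those
  containing its ends.\<close>

lemma sum_partition_delta:
  fixes x :: "'a set \<Rightarrow> real"
  assumes V: "finite V" and E: "E \<subseteq> complete_edges V" and W: "partition_on V W"
  shows "(\<Sum>S\<in>W. sum x (delta E S)) = 2 * sum x (delta_partition E W)"
proof -
  have fE: "finite E" using V E finite_complete_edges finite_subset by blast
  have fW: "finite W" by (rule finite_elements[OF V W])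
  have cd: "card {S \<in> W. e \<in> delta E S} = (if e \<in> delta_partition E W then 2 else 0)"
    if eE: "e \<in> E" for e
  proof -
    obtain u v where uv: "e = {u, v}" "u \<in> V" "v \<in> V" "u \<noteq> v"
      using subsetD[OF E eE] by (rule complete_edgesE)
    obtain A where A: "A \<in> W" "u \<in> A" using W uv by (auto simp: partition_on_def)
    obtain B where B: "B \<in> W" "v \<in> B" using W uv by (auto simp: partition_on_def)
    have uA: "S = A" if "S \<in> W" "u \<in> S" for S
      using that A W by (auto simp: partition_on_def disjoint_def)
    have vB: "S = B" if "S \<in> W" "v \<in> S" for S
      using that B W by (auto simp: partition_on_def disjoint_def)
    have iff: "e \<in> delta E S \<longleftrightarrow> (u \<in> S) \<noteq> (v \<in> S)" for S
      using card_pair_Int_eq_1[OF uv(4)] eE uv(1) by (simp add: delta_def)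
    have mem: "S \<in> W \<and> e \<in> delta E S \<longleftrightarrow> A \<noteq> B \<and> (S = A \<or> S = B)" for S
      unfolding iff using A B uA[of S] vB[of S] uA[of B] vB[of A] by blast
    then have "e \<in> delta_partition E W \<longleftrightarrow> A \<noteq> B"
      unfolding delta_partition_def by blast
    moreover have "{S \<in> W. e \<in> delta E S} = (if A = B then {} else {A, B})"
      unfolding mem by auto
    ultimately show ?thesis by simp
  qed
  have "(\<Sum>S\<in>W. sum x (delta E S)) = (\<Sum>S\<in>W. \<Sum>e\<in>E. if e \<in> delta E S then x e else 0)"
    by (rule sum.cong[OF refl]) (rule sum_eq_sum_if[OF fE delta_subset])
  also have "\<dots> = (\<Sum>e\<in>E. \<Sum>S\<in>W. if e \<in> delta E S then x e else 0)" by (rule sum.swap)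
  also have "\<dots> = (\<Sum>e\<in>E. real (card {S \<in> W. e \<in> delta E S}) * x e)"
    using fW by (intro sum.cong[OF refl]) (simp add: sum.inter_filter[symmetric])
  also have "\<dots> = (\<Sum>e\<in>E. if e \<in> delta_partition E W then 2 * x e else 0)"
    using cd by (intro sum.cong) auto
  also have "\<dots> = 2 * sum x (delta_partition E W)"
    unfolding sum_distrib_left
    by (rule sum_eq_sum_if[OF fE, symmetric]) (auto simp: delta_partition_def delta_def)
  finally show ?thesis .
qed

text \<open>Added over the classes, the bounds in \<open>cut\<close> give
  \<open>2 * card W - 2\<close>, as \<open>s\<close> and \<open>t\<close> lie in one class each;
  \<open>sum_partition_delta\<close> halves this. The one-class partition is treated apart because
  \<open>V\<close> is not a cut.\<close>

lemma partition_inequality: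
  fixes x :: "'a set \<Rightarrow> real"
  assumes V: "finite V" and E: "E \<subseteq> complete_edges V" and W: "partition_on V W"
    and st: "s \<in> V" "t \<in> V" and x: "\<And>e. e \<in> E \<Longrightarrow> x e \<ge> 0"
    and cut: "\<And>S. is_cut V S \<Longrightarrow>
      sum x (delta E S) \<ge> 2 - (if s \<in> S then 1 else 0) - (if t \<in> S then 1 else 0)"
  shows "sum x (delta_partition E W) \<ge> real (card W) - 1"
proof (cases "W = {V}")
  case True
  have "sum x (delta_partition E W) \<ge> 0"
    using x by (intro sum_nonneg) (auto simp: delta_partition_def delta_def)
  then show ?thesis using True by simp
next
  case False
  have fW: "finite W" by (rule finite_elements[OF V W])
  have one: "(\<Sum>S\<in>W. if v \<in> S then 1 else (0::real)) = 1" if v: "v \<in> V" for v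
  proof -
    obtain A where A: "A \<in> W" "v \<in> A" using W v by (auto simp: partition_on_def)
    have "v \<in> S \<longleftrightarrow> S = A" if "S \<in> W" for S
      using that A W by (auto simp: partition_on_def disjoint_def)
    then have "(\<Sum>S\<in>W. if v \<in> S then 1 else (0::real)) = (\<Sum>S\<in>W. if S = A then 1 else 0)"
      by (intro sum.cong[OF refl]) simp
    then show ?thesis using A fW by simp
  qed
  have "is_cut V S" if "S \<in> W" for S
  proof -
    have "S \<subseteq> V" "S \<noteq> {}" using that W by (auto simp: partition_on_def)
    moreover have "S \<noteq> V"
    proof
      assume S: "S = V"
      have "T = V" if T: "T \<in> W" for T
      proof (rule ccontr)
        assume "T \<noteq> V"
        then have "T \<inter> V = {}"
          using disjointD[OF partition_onD2[OF W] T \<open>S \<in> W\<close>] S by simp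
        moreover have "T \<subseteq> V" "T \<noteq> {}" using T W by (auto simp: partition_on_def)
        ultimately show False by blast
      qed
      with \<open>S \<in> W\<close> S False show False by blast
    qed
    ultimately show ?thesis by (auto simp: is_cut_def)
  qed
  then have "(\<Sum>S\<in>W. 2 - (if s \<in> S then 1 else 0) - (if t \<in> S then 1 else (0::real)))
      \<le> (\<Sum>S\<in>W. sum x (delta E S))"
    using cut by (intro sum_mono) blast
  also have "\<dots> = 2 * sum x (delta_partition E W)" by (rule sum_partition_delta[OF V E W])
  finally show ?thesis using one[OF st(1)] one[OF st(2)] by (simp add: sum_subtractf)
qed

subsection \<open>From (L.P.1) to (L.P.4)\<close>

lemma odd_sum_delta_LP1:
  assumes "finite V" "S \<subseteq> V" "s \<noteq> t"
    and feas: "LP1_feasible V (complete_edges V) s t (\<lambda>e. real (n e))"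
  shows "odd (sum n (delta (complete_edges V) S)) \<longleftrightarrow> odd (card (S \<inter> {s, t}))"
proof (rule odd_sum_delta_iff[OF assms(1) order.refl assms(2,3)])
  fix v assume v: "v \<in> V"
  have "real (sum n (delta (complete_edges V) {v})) = real (if v \<in> {s, t} then 1 else 2)"
    using feas v unfolding LP1_feasible_def of_nat_sum by auto
  then have "sum n (delta (complete_edges V) {v}) = (if v \<in> {s, t} then 1 else 2)"
    by (simp only: of_nat_eq_iff)
  then show "odd (sum n (delta (complete_edges V) {v})) \<longleftrightarrow> (v = s) \<noteq> (v = t)"
    using assms(3) by auto
qed

text \<open>Each edge \<open>e\<close> is replaced by \<open>n e\<close> copies of a shortest path
  \<open>P e\<close>, and \<open>m f\<close> counts the resulting uses of \<open>f\<close>. The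
  conclusion on parities is kept for the lower bound on the cycle.\<close>

lemma expand_LP1:
  fixes n :: "'a set \<Rightarrow> nat"
  assumes G: "connected_graph V E" and st: "s \<in> V" "t \<in> V" "s \<noteq> t"
    and feas: "LP1_feasible V (complete_edges V) s t (\<lambda>e. real (n e))"
  obtains m :: "'a set \<Rightarrow> nat" where "LP4_feasible V E s t (\<lambda>e. real (m e))"
    "(\<Sum>f\<in>E. c f * real (m f)) = (\<Sum>e\<in>complete_edges V. metric_cost V E c e * real (n e))"
    "\<forall>S\<subseteq>V. odd (sum m (delta E S)) \<longleftrightarrow> odd (card (S \<inter> {s, t}))"
proof -
  let ?K = "complete_edges V"
  have gr: "graph V E" using G by (simp add: connected_graph_def)
  note fin = graph_finite[OF gr]
  have fK: "finite ?K" using fin(1) by (rule finite_complete_edges)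
  have "\<exists>p. is_path V E p \<and> {hd p, last p} = e \<and> path_cost c p = metric_cost V E c e"
    if "e \<in> ?K" for e
    using that metric_cost_attained[OF G] by (metis complete_edgesE)
  then obtain P where P: "\<And>e. e \<in> ?K \<Longrightarrow> is_path V E (P e)"
    "\<And>e. e \<in> ?K \<Longrightarrow> {hd (P e), last (P e)} = e"
    "\<And>e. e \<in> ?K \<Longrightarrow> path_cost c (P e) = metric_cost V E c e" by metis
  have PE: "set (walk_edges (P e)) \<subseteq> E" if "e \<in> ?K" for e
    using P(1)[OF that] by (simp add: is_path_iff)
  define m where "m f = (\<Sum>e\<in>?K. n e * count_list (walk_edges (P e)) f)" for f
  have sum_m: "sum m F = (\<Sum>e\<in>?K. n e * length (filter (\<lambda>f. f \<in> F) (walk_edges (P e))))"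
    if "F \<subseteq> E" for F
  proof -
    have "sum m F = (\<Sum>e\<in>?K. n e * (\<Sum>f\<in>F. count_list (walk_edges (P e)) f))"
      unfolding m_def by (subst sum.swap) (simp add: sum_distrib_left)
    then show ?thesis using sum_count_list[OF fin(2) that PE] by simp
  qed
  have sum_delta: "sum m (delta E S) = (\<Sum>e\<in>?K. n e * crossings S (P e))" for S
  proof -
    have "sum m (delta E S) = (\<Sum>e\<in>?K. n e * (\<Sum>f\<in>delta E S. count_list (walk_edges (P e)) f))"
      unfolding m_def by (subst sum.swap) (simp add: sum_distrib_left)
    then show ?thesis using sum_delta_count_list[OF fin(2) PE] by simp
  qed
  have odd_crossings: "odd (crossings S (P e)) \<longleftrightarrow> e \<in> delta ?K S" if "e \<in> ?K" for e S
  proof -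
    have "P e \<noteq> []" using P(1)[OF that] by (simp add: is_path_def)
    then have "odd (crossings S (P e)) \<longleftrightarrow> (hd (P e) \<in> S) \<noteq> (last (P e) \<in> S)"
      using crossings_walk_parity[OF _ PE[OF that] fin(3)] by blast
    moreover have "hd (P e) \<noteq> last (P e)" using P(2)[OF that] that in_complete_edges by metis
    ultimately show ?thesis
      using card_pair_Int_eq_1[of "hd (P e)" "last (P e)" S] P(2)[OF that] that
      by (simp add: delta_def)
  qed
  have restrict: "sum n D = (\<Sum>e\<in>?K. if e \<in> D then n e else 0)" if "D \<subseteq> ?K" for D
    by (rule sum_eq_sum_if[OF fK that])
  \<comment> \<open>A path whose ends are separated by \<open>S\<close> crosses it an odd number of
    times, hence at least once.\<close>
  have cut_le: "sum n (delta ?K S) \<le> sum m (delta E S)" for S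
    unfolding sum_delta restrict[OF delta_subset]
    by (intro sum_mono) (use odd_crossings in \<open>auto simp: odd_pos Suc_le_eq\<close>)
  have part_le: "sum n (delta_partition ?K W) \<le> sum m (delta_partition E W)" for W
  proof -
    have sub: "delta_partition E W \<subseteq> E" "delta_partition ?K W \<subseteq> ?K"
      by (auto simp: delta_partition_def delta_def)
    have "n e \<le> n e * length (filter (\<lambda>f. f \<in> delta_partition E W) (walk_edges (P e)))"
      if e: "e \<in> delta_partition ?K W" for e
    proof -
      \<comment> \<open>Some class \<open>S\<close> separates the ends of \<open>e\<close>, so
        \<open>P e\<close> has an edge across the boundary of \<open>S\<close>, which belongs to
        \<open>delta_partition E W\<close>.\<close>
      obtain S where S: "S \<in> W" "e \<in> delta ?K S" using e by (auto simp: delta_partition_def)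
      then have eK: "e \<in> ?K" by (simp add: delta_def)
      have "crossings S (P e) \<noteq> 0" using odd_crossings[OF eK, of S] S(2) by (metis even_zero)
      then obtain f where f: "f \<in> set (walk_edges (P e))" "card (f \<inter> S) = 1"
        by (auto simp: crossings_def filter_empty_conv)
      then have "f \<in> delta_partition E W"
        using S(1) PE[OF eK] by (auto simp: delta_partition_def delta_def)
      with f have "length (filter (\<lambda>f. f \<in> delta_partition E W) (walk_edges (P e))) \<noteq> 0"
        by (auto simp: filter_empty_conv)
      then show ?thesis by (cases "length (filter (\<lambda>f. f \<in> delta_partition E W) (walk_edges (P e)))") auto
    qed
    then show ?thesis unfolding sum_m[OF sub(1)] restrict[OF sub(2)] by (intro sum_mono) auto
  qed
  have "real (card W) - 1 \<le> (\<Sum>e\<in>delta_partition E W. real (m e))" if W: "partition_on V W" for W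
  proof -
    \<comment> \<open>The form required by \<open>partition_inequality\<close>: the right-hand side
      is 1 for cuts separating \<open>s\<close> from \<open>t\<close> and at most 2 for all
      others.\<close>
    have "(\<Sum>e\<in>delta ?K S. real (n e)) \<ge> 2 - (if s \<in> S then 1 else 0) - (if t \<in> S then 1 else 0)"
      if S: "is_cut V S" for S
    proof (cases "(s \<in> S) = (t \<in> S)")
      case True
      then have "even (card (S \<inter> {s, t}))" using odd_card_Int_pair[OF st(3), of S] by simp
      then have "(\<Sum>e\<in>delta ?K S. real (n e)) \<ge> 2"
        using feas S unfolding LP1_feasible_def by blast
      then show ?thesis by simp
    next
      case False
      then have "card (S \<inter> {s, t}) = 1"
        using odd_card_Int_pair[OF st(3), of S] card_Int_pair_eq_1[OF st(3), of S] by simp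
      then have "(\<Sum>e\<in>delta ?K S. real (n e)) \<ge> 1"
        using feas S unfolding LP1_feasible_def by blast
      with False show ?thesis by auto
    qed
    then have "real (card W) - 1 \<le> (\<Sum>e\<in>delta_partition ?K W. real (n e))"
      by (intro partition_inequality[OF fin(1) order.refl W st(1,2)]) auto
    also have "\<dots> \<le> (\<Sum>e\<in>delta_partition E W. real (m e))"
      using part_le[of W] by (simp flip: of_nat_sum)
    finally show ?thesis .
  qed
  moreover have "2 \<le> (\<Sum>e\<in>delta E S. real (m e))" if "is_cut V S" "even (card (S \<inter> {s, t}))" for S
  proof -
    have "2 \<le> (\<Sum>e\<in>delta ?K S. real (n e))" using feas that unfolding LP1_feasible_def by blast
    also have "\<dots> \<le> (\<Sum>e\<in>delta E S. real (m e))" using cut_le[of S] by (simp flip: of_nat_sum)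
    finally show ?thesis .
  qed
  ultimately have "LP4_feasible V E s t (\<lambda>e. real (m e))" by (simp add: LP4_feasible_def)
  moreover have "(\<Sum>f\<in>E. c f * real (m f)) = (\<Sum>e\<in>?K. metric_cost V E c e * real (n e))"
  proof -
    have "(\<Sum>f\<in>E. c f * real (m f))
        = (\<Sum>f\<in>E. \<Sum>e\<in>?K. c f * (real (n e) * real (count_list (walk_edges (P e)) f)))"
      by (simp add: m_def sum_distrib_left)
    also have "\<dots> = (\<Sum>e\<in>?K. \<Sum>f\<in>E. c f * (real (n e) * real (count_list (walk_edges (P e)) f)))"
      by (rule sum.swap)
    also have "\<dots> = (\<Sum>e\<in>?K. path_cost c (P e) * real (n e))"
    proof (rule sum.cong)
      fix e assume "e \<in> ?K"
      then have "path_cost c (P e) = (\<Sum>f\<in>E. c f * real (count_list (walk_edges (P e)) f))"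
        unfolding path_cost_eq by (rule sum_list_count_list[OF fin(2) PE])
      then show "(\<Sum>f\<in>E. c f * (real (n e) * real (count_list (walk_edges (P e)) f)))
          = path_cost c (P e) * real (n e)"
        by (simp add: sum_distrib_right sum_distrib_left mult_ac)
    qed simp
    finally show ?thesis using P(3) by simp
  qed
  moreover have "odd (sum m (delta E S)) \<longleftrightarrow> odd (card (S \<inter> {s, t}))" if "S \<subseteq> V" for S
  proof -
    \<comment> \<open>Modulo 2 a path contributes to a cut iff its ends are separated, so
      \<open>n\<close> and \<open>m\<close> have the same cut parities.\<close>
    have "{e \<in> ?K. odd (n e * crossings S (P e))} = {e \<in> delta ?K S. odd (n e)}"
      using odd_crossings by (auto simp: delta_def)
    then have "odd (sum m (delta E S)) \<longleftrightarrow> odd (sum n (delta ?K S))"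
      unfolding sum_delta using fK finite_subset[OF delta_subset fK]
      by (simp add: even_sum_iff)
    then show ?thesis using odd_sum_delta_LP1[OF fin(1) that st(3) feas] by simp
  qed
  ultimately show ?thesis using that by blast
qed

subsection \<open>Existence of optima\<close>

lemma integral_representation:
  assumes "\<forall>e\<in>E. x e \<in> \<int>" "\<And>e. e \<in> E \<Longrightarrow> x e \<ge> (0::real)"
  obtains n :: "'b \<Rightarrow> nat" where "\<And>e. e \<in> E \<Longrightarrow> x e = real (n e)"
proof
  fix e assume "e \<in> E"
  then show "x e = real (nat \<lfloor>x e\<rfloor>)" using assms by (auto elim: Ints_cases)
qed

text \<open>Feasible values may be unbounded. Capping them at \<open>M\<close> keeps feasibility and
  does not raise a nonnegative cost, so it is enough to minimize over finitely many vectors on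
  \<open>E\<close>.\<close>

lemma is_min_int_cost_exists:
  fixes M :: nat
  assumes E: "finite E" and c: "\<forall>e\<in>E. c e \<ge> 0"
    and cong: "\<And>x y. (\<And>e. e \<in> E \<Longrightarrow> x e = y e) \<Longrightarrow> feasible x \<longleftrightarrow> feasible y"
    and nonneg: "\<And>x e. feasible x \<Longrightarrow> e \<in> E \<Longrightarrow> x e \<ge> 0"
    and trunc: "\<And>n :: 'a set \<Rightarrow> nat. feasible (\<lambda>e. real (n e)) \<Longrightarrow> feasible (\<lambda>e. real (min (n e) M))"
    and ex: "feasible (\<lambda>e. real (n0 e))"
  shows "\<exists>m. is_min_int_cost E c feasible m"
proof -
  define A where "A = {n \<in> PiE E (\<lambda>_. {..M}). feasible (\<lambda>e. real (n e))}"
  define cost where "cost n = (\<Sum>e\<in>E. c e * real (n e))" for n :: "'a set \<Rightarrow> nat"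
  have "finite A" using E by (simp add: A_def finite_PiE)
  then have fin: "finite (cost ` A)" by blast
  have below: "\<exists>k\<in>A. cost k \<le> (\<Sum>e\<in>E. c e * x e)" if x: "feasible x" "\<forall>e\<in>E. x e \<in> \<int>" for x
  proof -
    obtain n :: "'a set \<Rightarrow> nat" where n: "\<And>e. e \<in> E \<Longrightarrow> x e = real (n e)"
      using integral_representation[OF x(2)] nonneg[OF x(1)] by metis
    then have "feasible (\<lambda>e. real (n e))" using x(1) cong[of x "\<lambda>e. real (n e)"] by simp
    then have "feasible (\<lambda>e. real (min (n e) M))" by (rule trunc)
    \<comment> \<open>Restricting fixes the values outside \<open>E\<close>, which makes
      \<open>A\<close> finite; \<open>cong\<close> transfers feasibility.\<close>
    moreover define k where "k = restrict (\<lambda>e. min (n e) M) E"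
    ultimately have "feasible (\<lambda>e. real (k e))"
      using cong[of "\<lambda>e. real (min (n e) M)" "\<lambda>e. real (k e)"] by simp
    then have "k \<in> A" by (simp add: A_def k_def)
    moreover have "cost k \<le> (\<Sum>e\<in>E. c e * x e)"
      unfolding cost_def using c n by (intro sum_mono mult_left_mono) (auto simp: k_def)
    ultimately show ?thesis by blast
  qed
  have "A \<noteq> {}" using below[OF ex] by auto
  then obtain k where k: "k \<in> A" "cost k = Min (cost ` A)" using Min_in[OF fin] by fastforce
  have "Min (cost ` A) \<le> (\<Sum>e\<in>E. c e * x e)" if "feasible x" "\<forall>e\<in>E. x e \<in> \<int>" for x
    using below[OF that] Min_le[OF fin] by (meson imageI order.trans)
  then have "is_min_int_cost E c feasible (cost k)"
    unfolding is_min_int_cost_def k(2)[symmetric] using k(1)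
    by (intro conjI exI[of _ "\<lambda>e. real (k e)"]) (auto simp: A_def cost_def)
  then show ?thesis by blast
qed

text \<open>The cap is at least every right-hand side: a partition is a subset of
  \<open>Pow V\<close>, and even cuts demand 2. In each constraint either one edge at the cap
  suffices alone, or no value changes.\<close>

lemma LP4_feasible_truncate:
  assumes V: "finite V" and E: "E \<subseteq> complete_edges V"
    and feas: "LP4_feasible V E s t (\<lambda>e. real (n e))"
  shows "LP4_feasible V E s t (\<lambda>e. real (min (n e) (2 ^ card V + 2)))"
proof -
  have fE: "finite E" using V E finite_complete_edges finite_subset by blast
  have *: "(\<Sum>e\<in>D. real (min (n e) (2 ^ card V + 2))) \<ge> b"
    if "D \<subseteq> E" "(\<Sum>e\<in>D. real (n e)) \<ge> b" "b \<le> real (2 ^ card V + 2)" for D b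
  proof (cases "\<exists>e\<in>D. n e \<ge> 2 ^ card V + 2")
    case True
    then obtain e where e: "e \<in> D" "n e \<ge> 2 ^ card V + 2" by blast
    have "finite D" using that fE finite_subset by blast
    then have "real (min (n e) (2 ^ card V + 2)) \<le> (\<Sum>e\<in>D. real (min (n e) (2 ^ card V + 2)))"
      using e(1) by (intro member_le_sum) auto
    with e that show ?thesis by simp
  next
    case False
    then have "(\<Sum>e\<in>D. real (min (n e) (2 ^ card V + 2))) = (\<Sum>e\<in>D. real (n e))"
      by (intro sum.cong) auto
    with that show ?thesis by simp
  qed
  have "real (card W) - 1 \<le> (\<Sum>e\<in>delta_partition E W. real (min (n e) (2 ^ card V + 2)))"
    if W: "partition_on V W" for W
  proof (rule *)
    show "delta_partition E W \<subseteq> E" by (auto simp: delta_partition_def delta_def)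
    show "real (card W) - 1 \<le> (\<Sum>e\<in>delta_partition E W. real (n e))"
      using feas W by (simp add: LP4_feasible_def)
    have "card W \<le> card (Pow V)"
      using W V by (intro card_mono) (auto simp: partition_on_def)
    then have "card W \<le> 2 ^ card V" using V by (simp add: card_Pow)
    then show "real (card W) - 1 \<le> real (2 ^ card V + 2)" by linarith
  qed
  moreover have "2 \<le> (\<Sum>e\<in>delta E S. real (min (n e) (2 ^ card V + 2)))"
    if "is_cut V S" "even (card (S \<inter> {s, t}))" for S
    using feas that by (intro * delta_subset) (auto simp: LP4_feasible_def)
  ultimately show ?thesis by (simp add: LP4_feasible_def)
qed

lemma st_optima:
  assumes inst: "st_instance V E c s t"
  shows "\<exists>opt1 opt4. is_Opt_int_LP1 V E c s t opt1 \<and> is_Opt_int_LP4 V E c s t opt4 \<and>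
    opt4 \<le> opt1 \<and> opt1 \<le> 3 / 2 * opt4"
proof -
  have G: "connected_graph V E" and c: "\<forall>e\<in>E. c e \<ge> 0" and st: "s \<in> V" "t \<in> V" "s \<noteq> t"
    using inst by (auto simp: st_instance_def)
  have gr: "graph V E" using G by (simp add: connected_graph_def)
  note fin = graph_finite[OF gr]
  let ?K = "complete_edges V"
  have fK: "finite ?K" using fin(1) by (rule finite_complete_edges)
  have mc: "\<forall>e\<in>?K. metric_cost V E c e \<ge> 0"
    using metric_cost_nonneg[OF G c] by (metis complete_edgesE)
  have hamiltonian_cost: "(\<Sum>e\<in>?K. metric_cost V E c e * real (count_list (walk_edges q) e))
      = path_cost (metric_cost V E c) q" if "distinct q" "set q = V" for q
    unfolding path_cost_eq using that
    by (intro sum_list_count_list[OF fK, symmetric] distinct_walk_edges_complete) auto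
  \<comment> \<open>Any order of the other vertices between \<open>s\<close> and \<open>t\<close>
    gives a feasible vector of (L.P.1), and its expansion one of (L.P.4); the existence of both
    minima rests on these.\<close>
  obtain q where q: "distinct q" "set q = V" "hd q = s" "last q = t"
  proof -
    obtain r where r: "set r = V - {s, t}" "distinct r"
      using fin(1) finite_distinct_list[of "V - {s, t}"] by auto
    show ?thesis using r st by (intro that[of "s # r @ [t]"]) auto
  qed
  have LP1: "LP1_feasible V ?K s t (\<lambda>e. real (count_list (walk_edges q) e))"
    by (rule LP1_feasible_hamiltonian[OF fin(1) q st(3,1)])
  obtain m0 :: "'a set \<Rightarrow> nat" where LP4: "LP4_feasible V E s t (\<lambda>e. real (m0 e))"
    using expand_LP1[OF G st LP1] by blast
  have "\<exists>m. is_min_int_cost ?K (metric_cost V E c) (LP1_feasible V ?K s t) m"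
  proof (rule is_min_int_cost_exists[where M = 1 and feasible = "LP1_feasible V ?K s t"
        and ?n0.0 = "count_list (walk_edges q)", OF fK mc _ _ _ LP1])
    fix n :: "'a set \<Rightarrow> nat" assume n: "LP1_feasible V ?K s t (\<lambda>e. real (n e))"
    then have "\<And>e. e \<in> ?K \<Longrightarrow> n e \<le> 1" by (auto simp: LP1_feasible_def)
    then show "LP1_feasible V ?K s t (\<lambda>e. real (min (n e) 1))"
      using n by (subst LP1_feasible_cong[of _ _ "\<lambda>e. real (n e)"]) (auto simp: min_absorb1)
  qed (rule LP1_feasible_cong, simp, simp add: LP1_feasible_def)
  then obtain opt1 where opt1: "is_Opt_int_LP1 V E c s t opt1" by (auto simp: is_Opt_int_LP1_def)
  have "\<exists>m. is_min_int_cost E c (LP4_feasible V E s t) m"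
    by (rule is_min_int_cost_exists[where M = "2 ^ card V + 2"
          and feasible = "LP4_feasible V E s t" and ?n0.0 = m0, OF fin(2) c _ _ _ LP4])
      (rule LP4_feasible_cong, simp, simp add: LP4_feasible_def,
        rule LP4_feasible_truncate[OF fin(1,3)])
  then obtain opt4 where opt4: "is_Opt_int_LP4 V E c s t opt4" by (auto simp: is_Opt_int_LP4_def)
  have "opt4 \<le> opt1"
  proof -
    obtain x where x: "LP1_feasible V ?K s t x" "\<forall>e\<in>?K. x e \<in> \<int>"
      "(\<Sum>e\<in>?K. metric_cost V E c e * x e) = opt1"
      using opt1 by (auto simp: is_Opt_int_LP1_def is_min_int_cost_def)
    have "\<And>e. e \<in> ?K \<Longrightarrow> x e \<ge> 0" using x(1) by (simp add: LP1_feasible_def)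
    then obtain n :: "'a set \<Rightarrow> nat" where n: "\<And>e. e \<in> ?K \<Longrightarrow> x e = real (n e)"
      using integral_representation[OF x(2)] by metis
    then have "LP1_feasible V ?K s t (\<lambda>e. real (n e))"
      using x(1) LP1_feasible_cong[of ?K x "\<lambda>e. real (n e)"] by simp
    from expand_LP1[OF G st this, of c] obtain m :: "'a set \<Rightarrow> nat"
      where "LP4_feasible V E s t (\<lambda>e. real (m e))"
        "(\<Sum>f\<in>E. c f * real (m f)) = (\<Sum>e\<in>?K. metric_cost V E c e * real (n e))" by metis
    then show ?thesis using opt4 x(3) n by (auto simp: is_Opt_int_LP4_def is_min_int_cost_def)
  qed
  moreover have "opt1 \<le> 3 / 2 * opt4"
  proof -
    obtain x where x: "LP4_feasible V E s t x" "\<forall>e\<in>E. x e \<in> \<int>" "(\<Sum>e\<in>E. c e * x e) = opt4"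
      using opt4 by (auto simp: is_Opt_int_LP4_def is_min_int_cost_def)
    have "\<And>e. e \<in> E \<Longrightarrow> x e \<ge> 0" using x(1) by (simp add: LP4_feasible_def)
    then obtain n :: "'a set \<Rightarrow> nat" where n: "\<And>e. e \<in> E \<Longrightarrow> x e = real (n e)"
      using integral_representation[OF x(2)] by metis
    then have "LP4_feasible V E s t (\<lambda>e. real (n e))"
      using x(1) LP4_feasible_cong[of E x "\<lambda>e. real (n e)"] by simp
    from hamiltonian_list_of_LP4[OF G c st this] obtain q where q: "distinct q" "set q = V"
      "hd q = s" "last q = t"
      "path_cost (metric_cost V E c) q \<le> 3 / 2 * (\<Sum>e\<in>E. c e * real (n e))" by metis
    have "opt1 \<le> (\<Sum>e\<in>?K. metric_cost V E c e * real (count_list (walk_edges q) e))"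
      using opt1 LP1_feasible_hamiltonian[OF fin(1) q(1-4) st(3,1)]
      by (auto simp: is_Opt_int_LP1_def is_min_int_cost_def)
    also have "\<dots> \<le> 3 / 2 * (\<Sum>e\<in>E. c e * real (n e))"
      using hamiltonian_cost q by simp
    also have "(\<Sum>e\<in>E. c e * real (n e)) = opt4" using x(3) n by simp
    finally show ?thesis .
  qed
  ultimately show ?thesis using opt1 opt4 by blast
qed

subsection \<open>Tight instances\<close>

lemma connected_graphI:
  assumes "graph V E" "V \<noteq> {}" "\<And>R. is_cut V R \<Longrightarrow> delta E R \<noteq> {}"
  shows "connected_graph V E"
proof -
  note fin = graph_finite[OF assms(1)]
  have "\<exists>q. is_path V E q \<and> hd q = u \<and> last q = v" if uv: "u \<in> V" "v \<in> V" for u v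
  proof -
    obtain p where p: "walk E u p v"
      using reach_or_cut[OF fin(3) uv] assms(3) uv unfolding is_cut_def by (metis empty_iff psubsetI)
    have "set p \<subseteq> V"
      using set_walk_subset[of p E V] p fin(3) uv complete_edges_Pow by (auto simp: walk_def)
    with walk_to_path[OF p, of V "\<lambda>_. 0"] show ?thesis by auto
  qed
  then show ?thesis using assms by (simp add: connected_graph_def)
qed

text \<open>A closed walk covering \<open>V\<close> crosses every cut a positive even number of
  times. The second conclusion yields connectivity through \<open>connected_graphI\<close>.\<close>

lemma LP4_feasible_closed_walk:
  assumes V: "finite V" and E: "E \<subseteq> complete_edges V" "set (walk_edges p) \<subseteq> E"
    and p: "p \<noteq> []" "hd p = last p" "set p = V" and st: "s \<in> V" "t \<in> V"
  shows "LP4_feasible V E s t (\<lambda>e. real (count_list (walk_edges p) e))"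
    and "is_cut V S \<Longrightarrow> delta E S \<noteq> {}"
proof -
  have fE: "finite E" using V E finite_complete_edges finite_subset by blast
  have sum: "(\<Sum>e\<in>delta E S. real (count_list (walk_edges p) e)) = real (crossings S p)" for S
    using sum_delta_count_list[OF fE E(2), of S] by (simp flip: of_nat_sum)
  have two: "crossings S p \<ge> 2" if "is_cut V S" for S
  proof -
    have "even (crossings S p)" using crossings_walk_parity[OF p(1) E(2,1), of S] p(2) by simp
    moreover have "crossings S p \<noteq> 0"
      using crossings_eq_0[of S p] E complete_edges_card that p(3) unfolding is_cut_def by blast
    ultimately show ?thesis by presburger
  qed
  have "real (card W) - 1 \<le> (\<Sum>e\<in>delta_partition E W. real (count_list (walk_edges p) e))"
    if "partition_on V W" for W
  proof (rule partition_inequality[OF V E(1) that st])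
    fix S assume "is_cut V S"
    then have "real (crossings S p) \<ge> 2" using two by (metis of_nat_le_iff of_nat_numeral)
    then show "2 - (if s \<in> S then 1 else 0) - (if t \<in> S then 1 else 0)
        \<le> (\<Sum>e\<in>delta E S. real (count_list (walk_edges p) e))"
      unfolding sum by simp
  qed simp
  moreover have "2 \<le> real (crossings S p)" if "is_cut V S" for S
    using two[OF that] by (metis of_nat_le_iff of_nat_numeral)
  ultimately show "LP4_feasible V E s t (\<lambda>e. real (count_list (walk_edges p) e))"
    unfolding LP4_feasible_def sum by simp
  show "delta E S \<noteq> {}" if "is_cut V S"
    using two[OF that] sum[of S] by auto
qed

text \<open>The partition into singletons gives \<open>opt4 \<ge> 1\<close>; the bound
  \<open>y \<le> 1\<close> and metric cost at most 1 give \<open>opt1 \<le> 1\<close>. With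
  \<open>opt4 \<le> opt1\<close> all are equal.\<close>

lemma single_edge_instance:
  "\<exists>(V :: nat set) E c s t opt1 opt4. st_instance V E c s t \<and>
     is_Opt_int_LP1 V E c s t opt1 \<and> is_Opt_int_LP4 V E c s t opt4 \<and> opt4 > 0 \<and> opt1 = opt4"
proof -
  let ?V = "{0, 1 :: nat}" and ?E = "{{0, 1 :: nat}}" and ?c = "\<lambda>_ :: nat set. 1 :: real"
  have K: "complete_edges ?V = ?E"
  proof -
    have "e = {0, 1}" if "e \<in> complete_edges ?V" for e
      using that by (elim complete_edgesE) auto
    then show ?thesis using in_complete_edges[of 0 1 ?V] by auto
  qed
  have gr: "graph ?V ?E" unfolding graph_def K by simp
  have "delta ?E R \<noteq> {}" if "is_cut ?V R" for R
  proof -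
    have "(0 \<in> R) \<noteq> (1 \<in> R)" using that by (auto simp: is_cut_def)
    then have "{0, 1} \<in> delta ?E R"
      using card_pair_Int_eq_1[of 0 "1::nat" R] by (simp add: delta_def)
    then show ?thesis by blast
  qed
  then have inst: "st_instance ?V ?E ?c 0 1"
    using connected_graphI[OF gr] by (simp add: st_instance_def)
  from st_optima[OF this] obtain opt1 opt4 where opt: "is_Opt_int_LP1 ?V ?E ?c 0 1 opt1"
    "is_Opt_int_LP4 ?V ?E ?c 0 1 opt4" "opt4 \<le> opt1" by blast
  obtain x where x: "LP4_feasible ?V ?E 0 1 x" "(\<Sum>e\<in>?E. 1 * x e) = opt4"
    using opt(2) unfolding is_Opt_int_LP4_def is_min_int_cost_def by blast
  have "partition_on ?V {{0}, {1}}" by (auto simp: partition_on_def disjoint_def)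
  then have "sum x (delta_partition ?E {{0}, {1}}) \<ge> real (card {{0}, {1 :: nat}}) - 1"
    using x(1) unfolding LP4_feasible_def by blast
  moreover have "delta_partition ?E {{0}, {1}} = ?E"
    by (auto simp: delta_partition_def delta_def)
  ultimately have "opt4 \<ge> 1" using x(2) by simp
  obtain y where y: "LP1_feasible ?V ?E 0 1 y" "(\<Sum>e\<in>?E. metric_cost ?V ?E ?c e * y e) = opt1"
    using opt(1) unfolding is_Opt_int_LP1_def is_min_int_cost_def K by blast
  have "metric_cost ?V ?E ?c {0, 1} \<le> 1" using metric_cost_edge[OF gr, of ?c] by simp
  moreover have "0 \<le> y {0, 1}" "y {0, 1} \<le> 1" using y(1) by (auto simp: LP1_feasible_def)
  ultimately have "metric_cost ?V ?E ?c {0, 1} * y {0, 1} \<le> 1 * 1"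
    by (intro mult_mono) auto
  then have "opt1 \<le> 1" using y(2) by simp
  then have "opt4 > 0 \<and> opt1 = opt4" using \<open>opt4 \<ge> 1\<close> opt(3) by linarith
  with inst opt show ?thesis by blast
qed

text \<open>At most one value is 0 and all others are at least 2. The 2 stands on the left to avoid
  subtraction of naturals.\<close>

lemma sum_even_pairs:
  fixes a :: "'b \<Rightarrow> nat"
  assumes "finite B" "\<And>i. i \<in> B \<Longrightarrow> even (a i)"
    and "\<And>i j. i \<in> B \<Longrightarrow> j \<in> B \<Longrightarrow> i \<noteq> j \<Longrightarrow> a i + a j \<ge> 2"
  shows "sum a B + 2 \<ge> 2 * card B"
proof (cases "\<exists>b\<in>B. a b = 0")
  case True
  then obtain b where b: "b \<in> B" "a b = 0" by blast
  have "(\<Sum>i\<in>B - {b}. 2) \<le> sum a (B - {b})"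
    using assms(3)[OF _ b(1)] b(2) by (intro sum_mono) fastforce
  also have "\<dots> \<le> sum a B" using assms(1) by (intro sum_mono2) auto
  finally show ?thesis using b assms(1) by (simp add: card_Diff_singleton)
next
  case False
  then have "a i \<ge> 2" if "i \<in> B" for i
    using assms(2)[OF that] that by (metis even_zero dvd_imp_le neq0_conv)
  then have "(\<Sum>i\<in>B. 2) \<le> sum a B" by (intro sum_mono) auto
  then show ?thesis by simp
qed

lemma sum_odd_ge:
  fixes a :: "'b \<Rightarrow> nat"
  assumes "\<And>i. i \<in> A \<Longrightarrow> odd (a i)"
  shows "sum a A \<ge> card A"
  using sum_mono[of A "\<lambda>_. 1" a] assms by (simp add: odd_pos Suc_le_eq)

section \<open>Cycles with unit costs and antipodal terminals\<close>

definition cycle_edge :: "nat \<Rightarrow> nat \<Rightarrow> nat set" where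
  "cycle_edge N i = {i, Suc i mod N}"

lemma walk_edges_cycle:
  assumes "N > 0"
  shows "walk_edges ([0..<N] @ [0]) = map (cycle_edge N) [0..<N]"
proof (rule nth_equalityI)
  show "length (walk_edges ([0..<N] @ [0])) = length (map (cycle_edge N) [0..<N])"
    by (simp add: length_walk_edges)
  fix i assume "i < length (walk_edges ([0..<N] @ [0]))"
  then have i: "i < N" by (simp add: length_walk_edges)
  have "([0..<N] @ [0]) ! Suc i = Suc i mod N"
    using i by (cases "Suc i = N") (auto simp: nth_append)
  then show "walk_edges ([0..<N] @ [0]) ! i = map (cycle_edge N) [0..<N] ! i"
    using i by (subst nth_walk_edges) (auto simp: nth_append cycle_edge_def)
qed

text \<open>For \<open>N = 2\<close> the two edges coincide as sets, hence the bound on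
  \<open>N\<close>.\<close>

lemma inj_on_cycle_edge: "N \<ge> 3 \<Longrightarrow> inj_on (cycle_edge N) {..<N}"
  by (rule inj_onI) (auto simp: cycle_edge_def doubleton_eq_iff mod_Suc split: if_splits)

text \<open>Only the edges at the two ends of the arc cross it. Thus any two cycle edges form the
  boundary of an arc that avoids vertex 0.\<close>

lemma delta_cycle:
  assumes "i < j" "j < N"
  shows "delta (cycle_edge N ` {..<N}) {Suc i..j} = {cycle_edge N i, cycle_edge N j}"
proof -
  have "card (cycle_edge N m \<inter> {Suc i..j}) = 1 \<longleftrightarrow> m = i \<or> m = j" if m: "m < N" for m
  proof -
    have "m \<noteq> Suc m mod N" using m assms by (auto simp: mod_Suc)
    then have "card (cycle_edge N m \<inter> {Suc i..j}) = 1
        \<longleftrightarrow> (m \<in> {Suc i..j}) \<noteq> (Suc m mod N \<in> {Suc i..j})"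
      unfolding cycle_edge_def by (rule card_pair_Int_eq_1)
    moreover have "Suc m mod N \<in> {Suc i..j} \<longleftrightarrow> i \<le> m \<and> m < j"
      using m assms by (auto simp: mod_Suc)
    ultimately show ?thesis using assms by auto
  qed
  then show ?thesis using assms by (auto simp: delta_def)
qed

lemma cycle_instance:
  assumes k: "k \<ge> 2"
  defines "V \<equiv> {..<2 * k}" and "E \<equiv> cycle_edge (2 * k) ` {..<2 * k}"
  shows "st_instance V E (\<lambda>_. 1) 0 k"
    and "is_Opt_int_LP4 V E (\<lambda>_. 1) 0 k opt4 \<Longrightarrow> opt4 \<le> 2 * real k"
    and "is_Opt_int_LP1 V E (\<lambda>_. 1) 0 k opt1 \<Longrightarrow> opt1 \<ge> 3 * real k - 2"
proof -
  let ?p = "[0..<2 * k] @ [0]" and ?f = "cycle_edge (2 * k)" and ?K = "complete_edges V"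
  have N: "2 * k > 0" using k by simp
  have pE: "set (walk_edges ?p) = E"
    unfolding walk_edges_cycle[OF N] E_def by auto
  have V: "finite V" and stV: "0 \<in> V" "k \<in> V" and st: "(0::nat) \<noteq> k" using k by (auto simp: V_def)
  have E: "E \<subseteq> ?K"
    using k by (auto simp: E_def V_def cycle_edge_def in_complete_edges mod_Suc)
  have fE: "finite E" by (simp add: E_def)
  have p: "?p \<noteq> []" "hd ?p = last ?p" "set ?p = V" using k by (auto simp: V_def hd_append)
  note closed = LP4_feasible_closed_walk[OF V E equalityD1[OF pE] p stV]
  have gr: "graph V E" using V E by (simp add: graph_def)
  have G: "connected_graph V E" using connected_graphI[OF gr _ closed(2)] stV by blast
  show "st_instance V E (\<lambda>_. 1) 0 k" using G stV st by (simp add: st_instance_def)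
  show "opt4 \<le> 2 * real k" if "is_Opt_int_LP4 V E (\<lambda>_. 1) 0 k opt4"
  proof -
    have "opt4 \<le> (\<Sum>e\<in>E. 1 * real (count_list (walk_edges ?p) e))"
      using that closed(1) unfolding is_Opt_int_LP4_def is_min_int_cost_def by auto
    also have "\<dots> = sum_list (map (\<lambda>_. 1) (walk_edges ?p))"
      by (rule sum_list_count_list[OF fE equalityD1[OF pE], symmetric])
    also have "\<dots> = 2 * real k" by (simp add: sum_list_triv length_walk_edges)
    finally show ?thesis .
  qed
  show "opt1 \<ge> 3 * real k - 2" if opt1: "is_Opt_int_LP1 V E (\<lambda>_. 1) 0 k opt1"
  proof -
    obtain x where x: "LP1_feasible V ?K 0 k x" "\<forall>e\<in>?K. x e \<in> \<int>"
      "(\<Sum>e\<in>?K. metric_cost V E (\<lambda>_. 1) e * x e) = opt1"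
      using opt1 unfolding is_Opt_int_LP1_def is_min_int_cost_def by blast
    have "\<And>e. e \<in> ?K \<Longrightarrow> x e \<ge> 0" using x(1) by (simp add: LP1_feasible_def)
    then obtain n :: "nat set \<Rightarrow> nat" where n: "\<And>e. e \<in> ?K \<Longrightarrow> x e = real (n e)"
      using integral_representation[OF x(2)] by metis
    then have "LP1_feasible V ?K 0 k (\<lambda>e. real (n e))"
      using x(1) LP1_feasible_cong[of ?K x "\<lambda>e. real (n e)"] by simp
    then obtain m :: "nat set \<Rightarrow> nat" where
      m4: "LP4_feasible V E 0 k (\<lambda>e. real (m e))"
      and cost: "(\<Sum>f\<in>E. 1 * real (m f)) = (\<Sum>e\<in>?K. metric_cost V E (\<lambda>_. 1) e * real (n e))"
      and odd_m: "\<forall>S\<subseteq>V. odd (sum m (delta E S)) \<longleftrightarrow> odd (card (S \<inter> {0, k}))"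
      by (rule expand_LP1[where c = "\<lambda>_. 1", OF G stV st])
    define a where "a i = m (?f i)" for i
    have inj: "inj_on ?f {..<2 * k}" using k by (intro inj_on_cycle_edge) simp
    have sum_a: "sum m (delta E {Suc i..j}) = a i + a j" if "i < j" "j < 2 * k" for i j
    proof -
      have "?f i \<noteq> ?f j" using inj_onD[OF inj, of i j] that by auto
      then show ?thesis unfolding E_def delta_cycle[OF that] by (simp add: a_def)
    qed
    \<comment> \<open>The arc never contains the terminal 0, so it separates the terminals iff it
      contains \<open>k\<close>, that is, iff edges \<open>i\<close> and \<open>j\<close> lie on
      different sides of the cycle.\<close>
    have par: "odd (card ({Suc i..j} \<inter> {0, k})) \<longleftrightarrow> i < k \<and> k \<le> j" for i j
      unfolding odd_card_Int_pair[OF st] by auto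
    have odd_a: "odd (a i + a j) \<longleftrightarrow> i < k \<and> k \<le> j" if "i < j" "j < 2 * k" for i j
    proof -
      have "{Suc i..j} \<subseteq> V" using that by (auto simp: V_def)
      then show ?thesis using odd_m par[of i j] sum_a[OF that] by metis
    qed
    have "a i + a j \<ge> 2" if ij: "i < j" "j < 2 * k" "i < k \<longleftrightarrow> j < k" for i j
    proof -
      have "{Suc i..j} \<subseteq> V" "j \<in> {Suc i..j}" "0 \<notin> {Suc i..j}"
        using ij by (auto simp: V_def)
      then have "is_cut V {Suc i..j}" using stV(1) unfolding is_cut_def by blast
      moreover have "\<not> (i < k \<and> k \<le> j)" using ij(3) by linarith
      then have "even (card ({Suc i..j} \<inter> {0, k}))" using par[of i j] by metis
      ultimately have "(\<Sum>e\<in>delta E {Suc i..j}. real (m e)) \<ge> 2"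
        using m4 unfolding LP4_feasible_def by blast
      then have "real (a i + a j) \<ge> real 2"
        unfolding sum_a[OF ij(1,2), symmetric] by simp
      then show ?thesis by (simp only: of_nat_le_iff)
    qed
    then have pair: "a i + a j \<ge> 2"
      if "i < 2 * k" "j < 2 * k" "i \<noteq> j" "i < k \<longleftrightarrow> j < k" for i j
      using that by (metis add.commute nat_neq_iff)
    \<comment> \<open>Comparison with edge 0 fixes all parities: edges on its side agree with it,
      those on the other side are opposite.\<close>
    have low: "odd (a i) \<longleftrightarrow> odd (a 0)" if "i \<in> {..<k}" for i
      using odd_a[of 0 i] that by (cases "i = 0") auto
    have high: "odd (a i) \<longleftrightarrow> even (a 0)" if "i \<in> {k..<2 * k}" for i
      using odd_a[of 0 i] that k by auto
    have "sum a {..<k} + sum a {k..<2 * k} + 2 \<ge> 3 * k"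
    \<comment> \<open>The side with odd values contributes at least \<open>k\<close>, the other at
      least \<open>2 * k - 2\<close>; either side may be the odd one.\<close>
    proof (cases "odd (a 0)")
      case True
      have "sum a {..<k} \<ge> k" using sum_odd_ge[of "{..<k}" a] low True by simp
      moreover have "sum a {k..<2 * k} + 2 \<ge> 2 * card {k..<2 * k}"
        using high True by (intro sum_even_pairs pair) auto
      ultimately show ?thesis by simp
    next
      case False
      have "sum a {k..<2 * k} \<ge> k" using sum_odd_ge[of "{k..<2 * k}" a] high False by simp
      moreover have "sum a {..<k} + 2 \<ge> 2 * card {..<k}"
        using low False by (intro sum_even_pairs pair) auto
      ultimately show ?thesis by simp
    qed
    moreover have "sum a {..<2 * k} = sum a {..<k} + sum a {k..<2 * k}"
      by (subst sum.union_disjoint[symmetric]) (auto intro!: sum.cong)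
    moreover have "sum m E = sum a {..<2 * k}"
      unfolding E_def a_def by (rule sum.reindex_cong[OF inj]) auto
    ultimately have "real (sum m E) + 2 \<ge> 3 * real k" by linarith
    moreover have "real (sum m E) = opt1" using cost x(3) n by simp
    ultimately show ?thesis by linarith
  qed
qed

lemma ratio_near_three_halves:
  assumes "\<epsilon> > (0::real)"
  shows "\<exists>(V :: nat set) E c s t opt1 opt4. st_instance V E c s t \<and> (\<forall>e\<in>E. c e = 1) \<and>
     is_Opt_int_LP1 V E c s t opt1 \<and> is_Opt_int_LP4 V E c s t opt4 \<and>
     opt4 > 0 \<and> \<bar>opt1 / opt4 - 3 / 2\<bar> < \<epsilon>"
proof -
  obtain n where n: "inverse (real (Suc n)) < \<epsilon>" using reals_Archimedean[OF assms] by blast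
  \<comment> \<open>This gives both \<open>k \<ge> 2\<close>, as \<open>cycle_instance\<close>
    requires, and \<open>k > Suc n\<close>, hence \<open>1 / k < \<epsilon>\<close>.\<close>
  define k where "k = n + 2"
  have k: "k \<ge> 2" by (simp add: k_def)
  let ?V = "{..<2 * k}" and ?E = "cycle_edge (2 * k) ` {..<2 * k}" and ?c = "\<lambda>_ :: nat set. 1 :: real"
  note cyc = cycle_instance[OF k]
  obtain opt1 opt4 where opt: "is_Opt_int_LP1 ?V ?E ?c 0 k opt1" "is_Opt_int_LP4 ?V ?E ?c 0 k opt4"
    "opt1 \<le> 3 / 2 * opt4" using st_optima[OF cyc(1)] by blast
  have b: "opt4 \<le> 2 * real k" "opt1 \<ge> 3 * real k - 2" using cyc(2,3) opt by blast+
  have rk: "real k \<ge> 2" using k by simp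
  then have pos: "opt4 > 0" using b opt(3) by linarith
  have "inverse (real k) \<le> inverse (real (Suc n))" by (simp add: k_def)
  then have ik: "1 / real k < \<epsilon>" using n by (simp add: inverse_eq_divide)
  \<comment> \<open>The lower bound \<open>3 * k - 2\<close> over the upper bound
    \<open>2 * k\<close> falls short of \<open>3 / 2\<close> by exactly
    \<open>1 / k\<close>.\<close>
  have "3 / 2 - 1 / real k = (3 * real k - 2) / (2 * real k)" using rk by (simp add: field_simps)
  also have "\<dots> \<le> opt1 / opt4" using b rk pos by (intro frac_le) auto
  finally have "opt1 / opt4 \<ge> 3 / 2 - 1 / real k" .
  moreover have "opt1 / opt4 \<le> 3 / 2" using pos opt(3) by (simp add: pos_divide_le_eq)
  ultimately have "\<bar>opt1 / opt4 - 3 / 2\<bar> < \<epsilon>" using ik by linarith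
  with opt pos cyc(1) show ?thesis by (intro exI[of _ ?V] exI[of _ ?E] exI[of _ ?c]) blast
qed

theorem theorem5:
  shows "(\<forall>(V :: 'a set) E c s t. st_instance V E c s t \<longrightarrow>
            (\<exists>opt1 opt4. is_Opt_int_LP1 V E c s t opt1 \<and> is_Opt_int_LP4 V E c s t opt4 \<and>
               opt4 \<le> opt1 \<and> opt1 \<le> 3 / 2 * opt4)) \<and>
         (\<exists>(V :: nat set) E c s t opt1 opt4. st_instance V E c s t \<and>
            is_Opt_int_LP1 V E c s t opt1 \<and> is_Opt_int_LP4 V E c s t opt4 \<and>
            opt4 > 0 \<and> opt1 = opt4) \<and>
         (\<forall>\<epsilon>>0. \<exists>(V :: nat set) E c s t opt1 opt4. st_instance V E c s t \<and>
            (\<forall>e\<in>E. c e = 1) \<and>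
            is_Opt_int_LP1 V E c s t opt1 \<and> is_Opt_int_LP4 V E c s t opt4 \<and>
            opt4 > 0 \<and> \<bar>opt1 / opt4 - 3 / 2\<bar> < \<epsilon>)"
  using st_optima single_edge_instance ratio_near_three_halves by (intro conjI allI impI)

end
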